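(* Let $\mathscr{B}$ be a real Banach space, and let $X\subset\mathscr{B}$ be compact with $d_{\mathrm A}(X-X)<d<N$, where $N\in\mathbb{N}$ and $d\in\mathbb{R}$. Set $\alpha=1$ in general, and $\alpha=\tfrac12$ if $\mathscr{B}$ is in fact a Hilbert space. If $$\gamma>\frac{\alpha N+1}{N-d},$$ then a prevalent set of linear maps $L:\mathscr{B}\to\mathbb{R}^N$ is $\gamma$-almost bi-Lipschitz on $X$. That is, the set of all $L\in\mathscr{L}(\mathscr{B},\mathbb{R}^N)$ for which there exist constants $c_L>0$ and $\rho_L\in(0,1)$ such that $$\frac{1}{c_L}\,\frac{\|x-y\|}{|\log\|x-y\||^{\gamma}}\le |Lx-Ly|\le c_L\|x-y\|\qquad\text{for all }x,y\in X\text{ with }0<\|x-y\|\le\rho_L$$ is a prevalent subset of $\mathscr{L}(\mathscr{B},\mathbb{R}^N)$.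
   Context: $X-X=\{x-y: x,y\in X\}$. $\mathscr{L}(\mathscr{B},\mathbb{R}^N)$ is the normed space of bounded linear maps from $\mathscr{B}$ to $\mathbb{R}^N$ with the operator norm; $|\cdot|$ is the Euclidean norm on $\mathbb{R}^N$. A metric space $(Y,\rho_Y)$ is $(M,s)$-homogeneous if for all $0<\rho<r$ every ball of radius $r$ can be covered by at most $M(r/\rho)^s$ balls of radius $\rho$. The Assouad dimension $d_{\mathrm A}(Y)$ is the infimum of all $s$ such that $Y$ is $(M,s)$-homogeneous for some $M\ge1$. Subsets of $\mathscr{B}$ carry the metric induced by the norm. A subset $S$ of a normed linear space $V$ is prevalent if there exist a compactly supported (Borel) probability measure $\mu$ on $V$ and a Borel set $S'\subset S$ such that $\mu(v+S')=1$ for every $v\in V$. *)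

theory Defs
  imports "HOL-Probability.Probability"
begin

text \<open>
  A subset \<open>Y\<close> is viewed as a metric space of its own: its balls are traces on \<open>Y\<close> of ambient
  (open) balls whose centres lie in \<open>Y\<close>, both for the covered and for the covering balls.
\<close>

definition homogeneous_set :: "real \<Rightarrow> real \<Rightarrow> 'a::metric_space set \<Rightarrow> bool" where
  "homogeneous_set M s Y \<longleftrightarrow>
    (\<forall>\<rho> r. 0 < \<rho> \<and> \<rho> < r \<longrightarrow>
      (\<forall>y\<in>Y. \<exists>C. finite C \<and> C \<subseteq> Y \<and> real (card C) \<le> M * (r / \<rho>) powr s \<and>
        ball y r \<inter> Y \<subseteq> (\<Union>c\<in>C. ball c \<rho>)))"

text \<open>
  The value is \<open>\<infinity>\<close> if there is no admissible exponent. Negative exponents are admissible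
  only for the empty set, whose dimension is thus \<open>-\<infinity>\<close>.
\<close>

definition assouad_dim :: "'a::metric_space set \<Rightarrow> ereal" where
  "assouad_dim Y = (INF s\<in>{s::real. \<exists>M\<ge>1. homogeneous_set M s Y}. ereal s)"

definition difference_set :: "'a::real_normed_vector set \<Rightarrow> 'a set" where
  "difference_set X = {x - y |x y. x \<in> X \<and> y \<in> X}"

text \<open>
  ``Compactly supported'' means that the measure is concentrated on a compact set.
\<close>

definition prevalent :: "'v::real_normed_vector set \<Rightarrow> bool" where
  "prevalent S \<longleftrightarrow>
    (\<exists>\<mu> :: 'v measure. \<exists>K S'.
      prob_space \<mu> \<and> sets \<mu> = sets borel \<and>
      compact K \<and> emeasure \<mu> (- K) = 0 \<and>
      S' \<in> sets borel \<and> S' \<subseteq> S \<and>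
      (\<forall>v. emeasure \<mu> ((+) v ` S') = 1))"

text \<open>
  A Banach space is a Hilbert space if its norm comes from an inner product. This is a predicate
  on the type, so that the Banach and the Hilbert case can be treated in one statement.
\<close>

definition is_hilbert :: "'a::banach itself \<Rightarrow> bool" where
  "is_hilbert _ \<longleftrightarrow>
    (\<exists>ip :: 'a \<Rightarrow> 'a \<Rightarrow> real.
      bilinear ip \<and> (\<forall>x y. ip x y = ip y x) \<and> (\<forall>x. ip x x = (norm x)\<^sup>2))"

lemma is_hilbert_real_inner: "is_hilbert TYPE('a::{real_inner,banach})"
  unfolding is_hilbert_def
  by (rule exI[of _ inner])
    (auto simp: bilinear_def inner_commute power2_norm_eq_inner
      intro: bounded_linear.linear bounded_linear_inner_left bounded_linear_inner_right)

text \<open>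
  Since \<open>\<rho> < 1\<close>, the logarithm below never vanishes.
\<close>

definition almost_bilipschitz_on ::
    "real \<Rightarrow> 'a::real_normed_vector set \<Rightarrow> ('a \<Rightarrow> 'b::real_normed_vector) \<Rightarrow> bool" where
  "almost_bilipschitz_on \<gamma> X f \<longleftrightarrow>
    (\<exists>c>0. \<exists>\<rho>. 0 < \<rho> \<and> \<rho> < 1 \<and>
      (\<forall>x\<in>X. \<forall>y\<in>X. 0 < norm (x - y) \<and> norm (x - y) \<le> \<rho> \<longrightarrow>
        1 / c * (norm (x - y) / \<bar>ln (norm (x - y))\<bar> powr \<gamma>) \<le> norm (f x - f y) \<and>
        norm (f x - f y) \<le> c * norm (x - y)))"

end

theory Submission
  imports Defs
begin

text \<open>
  Write \<open>Z = X - X\<close> and group the scales \<open>2\<^sup>k \<le> n < 2\<^sup>k\<^sup>+\<^sup>1\<close> into the block \<open>k\<close>. By homogeneity the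
  annulus of \<open>Z\<close> of radius \<open>2 powr - n\<close> is covered by a number \<open>m\<close> of comparably small balls that does
  not depend on \<open>n\<close>, so block \<open>k\<close> is normed, up to a constant, by \<open>D = m 2\<^sup>k\<close> functionals \<open>\<psi> k i\<close>.
  The random map has as coordinates independent copies of
  \<open>\<Sum>k. 2 powr (- \<delta> k) * D powr (- \<alpha>) * (\<Sum>i<D. g k i * \<psi> k i)\<close> with independent standard normal
  variables \<open>g k i\<close>. Since the vector \<open>g k\<close> has length about \<open>sqrt D\<close>, the series converges absolutely
  in norm.

  For a fixed \<open>c\<close> in block \<open>k\<close>, and whatever the other blocks and the translation contribute, the
  value at \<open>c\<close> is smaller than \<open>\<epsilon> * norm c\<close> with probability at most a constant times
  \<open>(\<epsilon> * 2 powr ((\<alpha> + \<delta>) k)) ^ N\<close>. Taking \<open>\<epsilon> = 2 powr (- \<gamma> k)\<close>, and summing over the \<open>2\<^sup>k\<close> scales and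
  the \<open>O(2 powr (\<gamma> s k))\<close> balls of relative radius \<open>\<epsilon>\<close> at each of them, one gets a convergent geometric
  series if \<open>1 + \<gamma> s + N (\<alpha> + \<delta> - \<gamma>) < 0\<close>, which holds for small \<open>\<delta>\<close>. The Borel--Cantelli lemma
  finishes the argument.
\<close>

section \<open>Norming functionals in Banach spaces\<close>

definition sublinear :: "('a::real_vector \<Rightarrow> real) \<Rightarrow> bool" where
  "sublinear p \<longleftrightarrow> (\<forall>x y. p (x + y) \<le> p x + p y) \<and> (\<forall>t\<ge>0. \<forall>x. p (t *\<^sub>R x) = t * p x)"

lemma sublinear_zero: "sublinear p \<Longrightarrow> p 0 = 0"
  unfolding sublinear_def by (metis mult_zero_left order_refl scaleR_zero_left)

lemma sublinear_neg_lower: "sublinear p \<Longrightarrow> - p (- x) \<le> p x"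
  using sublinear_zero[of p] unfolding sublinear_def
  by (metis add.right_inverse add_le_cancel_left diff_0 diff_le_eq add.commute)

text \<open>It is enough that the index set absorbs scaling and addition. This form serves two
  families: the tilts of a functional, which are not homogeneous one by one, and a chain, where the
  smaller of two members is the index for a sum.\<close>

lemma sublinear_INF:
  assumes ne: "I \<noteq> {}" and bdd: "\<And>x. bdd_below ((\<lambda>i. p i x) ` I)"
    and hom: "\<And>i t x. i \<in> I \<Longrightarrow> t > 0 \<Longrightarrow> \<exists>j\<in>I. p j (t *\<^sub>R x) \<le> t * p i x"
    and sub: "\<And>i j x y. i \<in> I \<Longrightarrow> j \<in> I \<Longrightarrow> \<exists>k\<in>I. p k (x + y) \<le> p i x + p j y"
    and zero: "(INF i\<in>I. p i 0) = 0"
  shows "sublinear (\<lambda>x. INF i\<in>I. p i x)"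
proof -
  let ?q = "\<lambda>x. INF i\<in>I. p i x"
  have low: "?q x \<le> p i x" if "i \<in> I" for i x
    using that by (rule cINF_lower[OF bdd])
  have add: "?q (x + y) \<le> ?q x + ?q y" for x y
  proof -
    have "?q (x + y) - p j y \<le> ?q x" if j: "j \<in> I" for j
    proof (rule cINF_greatest[OF ne])
      fix i assume i: "i \<in> I"
      from sub[OF i j] obtain k where "k \<in> I" "p k (x + y) \<le> p i x + p j y" by blast
      with low[of k "x + y"] show "?q (x + y) - p j y \<le> p i x" by linarith
    qed
    then have "?q (x + y) - ?q x \<le> ?q y"
      by (intro cINF_greatest[OF ne]) (simp add: algebra_simps)
    then show ?thesis by linarith
  qed
  have le: "?q (t *\<^sub>R x) \<le> t * ?q x" if t: "t > 0" for t x
  proof -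
    have "?q (t *\<^sub>R x) / t \<le> ?q x"
    proof (rule cINF_greatest[OF ne])
      fix i assume i: "i \<in> I"
      from hom[OF i t] obtain j where "j \<in> I" "p j (t *\<^sub>R x) \<le> t * p i x" by blast
      with low[of j "t *\<^sub>R x"] show "?q (t *\<^sub>R x) / t \<le> p i x"
        using t by (simp add: field_simps)
    qed
    then show ?thesis using t by (simp add: field_simps)
  qed
  have ge: "t * ?q x \<le> ?q (t *\<^sub>R x)" if t: "t > 0" for t x
    using le[of "1 / t" "t *\<^sub>R x"] t by (simp add: field_simps)
  show ?thesis
    unfolding sublinear_def using add le ge zero
    by (metis antisym mult_zero_left order_le_less scaleR_zero_left)
qed

text \<open>
  This step shows that a minimal sublinear functional is additive, which replaces the usual
  one-dimensional extension in the Hahn--Banach theorem.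
\<close>

lemma sublinear_tilt:
  assumes p: "sublinear p"
  obtains q where "sublinear q" "\<And>x. q x \<le> p x" "\<And>x. q x \<le> p (x + y) - p y"
proof -
  \<comment> \<open>The parameter 0 gives \<open>q x \<le> p x\<close> and the parameter 1 gives the
    tilt. Ranging over all nonnegative parameters restores homogeneity, and \<open>- p (- x)\<close>
    keeps the infimum finite.\<close>
  define q where "q x = (INF t\<in>{0..}. p (x + t *\<^sub>R y) - t * p y)" for x
  have add: "p (a + b) \<le> p a + p b" for a b using p by (auto simp: sublinear_def)
  have hom: "p (t *\<^sub>R a) = t * p a" if "t \<ge> 0" for t a using p that by (auto simp: sublinear_def)
  have bd: "- p (- x) \<le> p (x + t *\<^sub>R y) - t * p y" if "t \<ge> 0" for x t
    using add[of "x + t *\<^sub>R y" "- x"] hom[OF that, of y] by simp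
  have bdd: "bdd_below ((\<lambda>t. p (x + t *\<^sub>R y) - t * p y) ` {0..})" for x
    by (rule bdd_belowI2[of _ "- p (- x)"]) (use bd in auto)
  have low: "q x \<le> p (x + t *\<^sub>R y) - t * p y" if "t \<ge> 0" for x t
    unfolding q_def using that by (intro cINF_lower[OF bdd]) auto
  have zero: "(INF t\<in>{0..}. p (0 + t *\<^sub>R y) - t * p y) = 0"
  proof -
    have "(INF t\<in>{0::real..}. p (0 + t *\<^sub>R y) - t * p y) = (INF t\<in>{0::real..}. 0)"
      by (rule INF_cong) (auto simp: hom)
    then show ?thesis by simp
  qed
  have sl: "sublinear (\<lambda>x. INF t\<in>{0..}. p (x + t *\<^sub>R y) - t * p y)"
  proof (rule sublinear_INF[where p = "\<lambda>t x. p (x + t *\<^sub>R y) - t * p y", OF _ bdd _ _ zero])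
    fix i t :: real and x assume i: "i \<in> {0..}" and t: "t > 0"
    have "p (t *\<^sub>R x + (t * i) *\<^sub>R y) = t * p (x + i *\<^sub>R y)"
      using hom[of t "x + i *\<^sub>R y"] t by (simp add: scaleR_add_right)
    then show "\<exists>j\<in>{0..}. p (t *\<^sub>R x + j *\<^sub>R y) - j * p y \<le> t * (p (x + i *\<^sub>R y) - i * p y)"
      using i t by (intro bexI[of _ "t * i"]) (auto simp: algebra_simps)
  next
    fix i j :: real and x z assume "i \<in> {0..}" "j \<in> {0..}"
    then show "\<exists>k\<in>{0..}. p (x + z + k *\<^sub>R y) - k * p y
        \<le> p (x + i *\<^sub>R y) - i * p y + (p (z + j *\<^sub>R y) - j * p y)"
      using add[of "x + i *\<^sub>R y" "z + j *\<^sub>R y"]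
      by (intro bexI[of _ "i + j"]) (auto simp: algebra_simps)
  qed simp
  show ?thesis
  proof
    show "sublinear q" using sl by (simp add: q_def[abs_def])
    show "q x \<le> p x" for x using low[of 0 x] by simp
    show "q x \<le> p (x + y) - p y" for x using low[of 1 x] by simp
  qed
qed

text \<open>Zorn's lemma below \<open>p\<close>. A chain is bounded by its pointwise infimum, which
  is finite because every sublinear \<open>q\<close> below \<open>p\<close> satisfies
  \<open>- p (- x) \<le> q x\<close>.\<close>

lemma minimal_sublinear:
  fixes p :: "'a::real_vector \<Rightarrow> real"
  assumes p: "sublinear p"
  obtains q where "sublinear q" "\<And>x. q x \<le> p x"
    "\<And>q' x. sublinear q' \<Longrightarrow> (\<And>y. q' y \<le> q y) \<Longrightarrow> q' x = q x"
proof -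
  define A where "A = {q. sublinear q \<and> q \<le> p}"
  \<comment> \<open>The order is reversed, since Zorn's lemma yields a maximal element.\<close>
  define P where "P = (\<lambda>q r :: 'a \<Rightarrow> real. r \<le> q)"
  have po: "partial_order_on A (relation_of P A)"
    by (rule partial_order_on_relation_ofI) (auto simp: P_def)
  have "\<exists>u\<in>A. \<forall>a\<in>C. P a u" if C: "C \<in> Chains (relation_of P A)" for C
  proof (cases "C = {}")
    case True
    then show ?thesis using p by (auto simp: A_def)
  next
    case False
    have CA: "q \<in> A" if "q \<in> C" for q
      using C that by (auto simp: Chains_def relation_of_def)
    have tot: "q \<le> r \<or> r \<le> q" if "q \<in> C" "r \<in> C" for q r
      using C that by (auto simp: Chains_def relation_of_def P_def)
    have bdd: "bdd_below ((\<lambda>q. q x) ` C)" for x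
    proof (rule bdd_belowI2[of _ "- p (- x)"])
      fix q assume "q \<in> C"
      with CA have q: "sublinear q" "q \<le> p" by (auto simp: A_def)
      from sublinear_neg_lower[OF q(1), of x] q(2) show "- p (- x) \<le> q x"
        by (meson dual_order.trans le_funD neg_le_iff_le)
    qed
    have sl: "sublinear (\<lambda>x. INF q\<in>C. q x)"
    proof (rule sublinear_INF[OF False bdd])
      fix q t and x :: 'a assume "q \<in> C" "(t::real) > 0"
      then show "\<exists>j\<in>C. j (t *\<^sub>R x) \<le> t * q x"
        using CA[of q] by (intro bexI[of _ q]) (auto simp: A_def sublinear_def)
    next
      fix q r and x y :: 'a assume qr: "q \<in> C" "r \<in> C"
      have sub: "s (x + y) \<le> s x + s y" if "s \<in> C" for s
        using CA[OF that] by (auto simp: A_def sublinear_def)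
      from tot[OF qr] show "\<exists>k\<in>C. k (x + y) \<le> q x + r y"
      proof
        assume "q \<le> r"
        with sub[OF qr(1)] show ?thesis
          by (intro bexI[OF _ qr(1)]) (meson add_left_mono dual_order.trans le_funD)
      next
        assume "r \<le> q"
        with sub[OF qr(2)] show ?thesis
          by (intro bexI[OF _ qr(2)]) (meson add_right_mono dual_order.trans le_funD)
      qed
    next
      have "(INF q\<in>C. q 0) = (INF q\<in>C. (0::real))"
        by (rule INF_cong) (use CA in \<open>auto simp: A_def sublinear_zero\<close>)
      then show "(INF q\<in>C. q 0) = 0" using False by simp
    qed
    have low: "(\<lambda>x. INF q\<in>C. q x) \<le> r" if "r \<in> C" for r
      using that by (intro le_funI cINF_lower[OF bdd])
    obtain r where r: "r \<in> C" using False by auto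
    have "(\<lambda>x. INF q\<in>C. q x) \<le> p"
      using low[OF r] CA[OF r] by (auto simp: A_def)
    with sl low show ?thesis
      by (intro bexI[of _ "\<lambda>x. INF q\<in>C. q x"]) (auto simp: A_def P_def)
  qed
  then obtain q where q: "q \<in> A" and qmin: "\<forall>a\<in>A. P q a \<longrightarrow> a = q"
    using predicate_Zorn[OF po] by metis
  show ?thesis
  proof
    show "sublinear q" "\<And>x. q x \<le> p x" using q by (auto simp: A_def le_fun_def)
    fix q' x assume "sublinear q'" "\<And>y. q' y \<le> q y"
    moreover from this have "q' \<in> A" using q by (auto simp: A_def le_fun_def intro: order_trans)
    ultimately have "q' = q" using qmin by (auto simp: P_def le_fun_def)
    then show "q' x = q x" by simp
  qed
qed

text \<open>Tilting the norm at \<open>c\<close> forces every functional below the tilt to be at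
  most \<open>- norm c\<close> at \<open>- c\<close>. A minimal sublinear functional below it is
  linear, so its value at \<open>c\<close> is as large as possible.\<close>

lemma norming_functional:
  fixes c :: "'a::real_normed_vector"
  obtains \<phi> :: "'a \<Rightarrow>\<^sub>L real" where "norm \<phi> \<le> 1" "blinfun_apply \<phi> c = norm c"
proof -
  have "sublinear (norm :: 'a \<Rightarrow> real)"
    by (auto simp: sublinear_def norm_triangle_ineq)
  then obtain p where p: "sublinear p" "\<And>x. p x \<le> norm x" "\<And>x. p x \<le> norm (x + c) - norm c"
    by (rule sublinear_tilt[of norm c]) blast
  obtain q where q: "sublinear q" "\<And>x. q x \<le> p x"
    and qmin: "\<And>q' x. sublinear q' \<Longrightarrow> (\<And>y. q' y \<le> q y) \<Longrightarrow> q' x = q x"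
    using minimal_sublinear[OF p(1)] by metis
  have add: "q (x + y) = q x + q y" for x y
  proof -
    \<comment> \<open>The tilt of \<open>q\<close> at \<open>y\<close> lies below \<open>q\<close>,
      so by minimality it equals \<open>q\<close>; its last property then becomes
      \<open>q x + q y \<le> q (x + y)\<close>.\<close>
    obtain q' where q': "sublinear q'" "\<And>x. q' x \<le> q x" "\<And>x. q' x \<le> q (x + y) - q y"
      using sublinear_tilt[OF q(1), of y] by metis
    have "q x \<le> q (x + y) - q y" using qmin[OF q'(1,2), of x] q'(3)[of x] by simp
    moreover have "q (x + y) \<le> q x + q y" using q(1) by (auto simp: sublinear_def)
    ultimately show ?thesis by linarith
  qed
  have neg: "q (- x) = - q x" for x
    using add[of x "- x"] sublinear_zero[OF q(1)] by simp
  have scale: "q (t *\<^sub>R x) = t * q x" for t x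
  proof (cases "t \<ge> 0")
    case True then show ?thesis using q(1) by (auto simp: sublinear_def)
  next
    case False
    then have "q ((- t) *\<^sub>R x) = (- t) * q x" using q(1) unfolding sublinear_def by (metis linear neg_0_le_iff_le)
    then show ?thesis using neg[of "t *\<^sub>R x"] by simp
  qed
  have le: "q x \<le> norm x" for x using q(2)[of x] p(2)[of x] by linarith
  have abs: "\<bar>q x\<bar> \<le> norm x" for x using le[of x] le[of "- x"] neg[of x] by simp
  have bl: "bounded_linear q"
    by (rule bounded_linear_intro[of q 1]) (auto simp: add scale abs)
  have eq: "blinfun_apply (Blinfun q) = q" by (rule bounded_linear_Blinfun_apply[OF bl])
  \<comment> \<open>At \<open>- c\<close> the tilted norm is at most
    \<open>norm 0 - norm c\<close>.\<close>
  have "q c = norm c"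
    using le[of c] neg[of c] q(2)[of "- c"] p(3)[of "- c"] by simp
  moreover have "norm (Blinfun q) \<le> 1"
    by (rule norm_blinfun_bound) (auto simp: eq abs)
  ultimately show ?thesis using that eq by metis
qed

section \<open>Norming families in Hilbert and Banach spaces\<close>

text \<open>The form comes from the predicate \<open>is_hilbert\<close> and not from a type class,
  so Cauchy--Schwarz and orthonormalisation are derived from these three properties.\<close>

locale hilbert_form =
  fixes ip :: "'a::real_normed_vector \<Rightarrow> 'a \<Rightarrow> real"
  assumes bilin: "bilinear ip" and sym: "ip x y = ip y x" and ip_self: "ip x x = (norm x)\<^sup>2"
begin

lemma ip_simps:
  "ip (x + y) z = ip x z + ip y z" "ip z (x + y) = ip z x + ip z y"
  "ip (x - y) z = ip x z - ip y z" "ip z (x - y) = ip z x - ip z y"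
  "ip (t *\<^sub>R x) z = t * ip x z" "ip z (t *\<^sub>R x) = t * ip z x"
  using bilin by (auto simp: bilinear_ladd bilinear_radd bilinear_lsub bilinear_rsub
      bilinear_lmul bilinear_rmul)

lemma ip_zero: "ip 0 x = 0" "ip x 0 = 0"
  using bilin by (auto simp: bilinear_lzero bilinear_rzero)

lemma ip_sum: "ip (\<Sum>i\<in>I. f i) z = (\<Sum>i\<in>I. ip (f i) z)" "ip z (\<Sum>i\<in>I. f i) = (\<Sum>i\<in>I. ip z (f i))"
  by (induction I rule: infinite_finite_induct) (auto simp: ip_simps ip_zero)

lemma ip_bound: "\<bar>ip x y\<bar> \<le> norm x * norm y"
proof (cases "norm x = 0 \<or> norm y = 0")
  case True
  then show ?thesis by (auto simp: ip_zero)
next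
  case False
  then have xy: "norm x > 0" "norm y > 0" by auto
  \<comment> \<open>The two terms of
    \<open>norm y *\<^sub>R x - (\<sigma> * norm x) *\<^sub>R y\<close> have equal length, and its
    squared norm is nonnegative. The two signs of \<open>\<sigma>\<close> together bound the
    absolute value.\<close>
  have *: "\<sigma> * ip x y \<le> norm x * norm y" if "\<sigma>\<^sup>2 = 1" for \<sigma>
  proof -
    have "0 \<le> (norm (norm y *\<^sub>R x - (\<sigma> * norm x) *\<^sub>R y))\<^sup>2" by simp
    also have "\<dots> = (norm y)\<^sup>2 * (norm x)\<^sup>2 - 2 * \<sigma> * norm x * norm y * ip x y
        + \<sigma>\<^sup>2 * (norm x)\<^sup>2 * (norm y)\<^sup>2"
      unfolding ip_self[symmetric] ip_simps sym[of y x] by (simp add: power2_eq_square ip_self algebra_simps)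
    finally have "2 * (norm x * norm y) * (\<sigma> * ip x y)
        \<le> (1 + \<sigma>\<^sup>2) * ((norm x * norm y) * (norm x * norm y))"
      by (simp add: power2_eq_square algebra_simps)
    also have "\<dots> = 2 * (norm x * norm y) * (norm x * norm y)" by (simp add: that)
    finally have "2 * (norm x * norm y) * (\<sigma> * ip x y) \<le> 2 * (norm x * norm y) * (norm x * norm y)" .
    then show ?thesis using xy by (simp add: mult_le_cancel_left)
  qed
  from *[of 1] *[of "-1"] show ?thesis by (simp add: abs_le_iff)
qed

lemma norm_sum_orthogonal:
  fixes D :: nat
  assumes "\<And>i j. i < D \<Longrightarrow> j < D \<Longrightarrow> i \<noteq> j \<Longrightarrow> ip (e i) (e j) = 0"
  shows "(norm (\<Sum>i<D. x i *\<^sub>R e i))\<^sup>2 = (\<Sum>i<D. (x i)\<^sup>2 * (norm (e i))\<^sup>2)"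
proof -
  have "(norm (\<Sum>i<D. x i *\<^sub>R e i))\<^sup>2 = (\<Sum>i<D. \<Sum>j<D. x j * (x i * ip (e j) (e i)))"
    unfolding ip_self[symmetric] ip_sum ip_simps
    by (simp add: sum_distrib_left mult.left_commute)
  also have "\<dots> = (\<Sum>i<D. \<Sum>j<D. if j = i then x i * (x i * ip (e i) (e i)) else 0)"
    using assms by (intro sum.cong) auto
  also have "\<dots> = (\<Sum>i<D. (x i)\<^sup>2 * (norm (e i))\<^sup>2)"
    by (intro sum.cong refl) (simp add: ip_self power2_eq_square)
  finally show ?thesis .
qed

text \<open>A vector that depends on its predecessors produces a zero entry of \<open>e\<close>
  instead of a shorter family. The index set thus stays \<open>i < D\<close>, and the expansions are
  unaffected.\<close>

lemma gram_schmidt: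
  fixes v :: "nat \<Rightarrow> 'a"
  shows "\<exists>e. (\<forall>i<D. norm (e i) = 0 \<or> norm (e i) = 1) \<and>
    (\<forall>i<D. \<forall>j<D. i \<noteq> j \<longrightarrow> ip (e i) (e j) = 0) \<and>
    (\<forall>l<D. v l = (\<Sum>i<D. ip (e i) (v l) *\<^sub>R e i))"
proof (induction D)
  case 0
  show ?case by simp
next
  case (Suc D)
  then obtain e where nrm: "\<And>i. i < D \<Longrightarrow> norm (e i) = 0 \<or> norm (e i) = 1"
    and orth: "\<And>i j. i < D \<Longrightarrow> j < D \<Longrightarrow> i \<noteq> j \<Longrightarrow> ip (e i) (e j) = 0"
    and rep: "\<And>l. l < D \<Longrightarrow> v l = (\<Sum>i<D. ip (e i) (v l) *\<^sub>R e i)"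
    by auto
  define w where "w = (\<Sum>i<D. ip (e i) (v D) *\<^sub>R e i)"
  define u where "u = v D - w"
  define f where "f = (if u = 0 then 0 else (1 / norm u) *\<^sub>R u)"
  have nf: "norm f = 0 \<or> norm f = 1" by (simp add: f_def)
  have eu: "ip (e j) u = 0" if j: "j < D" for j
  proof -
    have "ip (e j) w = (\<Sum>i<D. ip (e i) (v D) * ip (e j) (e i))"
      by (simp add: w_def ip_sum ip_simps)
    also have "\<dots> = (\<Sum>i<D. if i = j then ip (e j) (v D) * (norm (e j))\<^sup>2 else 0)"
      using orth[OF j] by (intro sum.cong) (auto simp: ip_self)
    also have "\<dots> = ip (e j) (v D) * (norm (e j))\<^sup>2" using j by simp
    also have "\<dots> = ip (e j) (v D)" using nrm[OF j] by (auto simp: ip_zero)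
    finally show ?thesis by (simp add: u_def ip_simps)
  qed
  have ef: "ip (e j) f = 0" "ip f (e j) = 0" if "j < D" for j
    using eu[OF that] sym[of f "e j"] by (auto simp: f_def ip_simps ip_zero)
  have fw: "ip f w = 0" by (simp add: w_def ip_sum ip_simps ef)
  have "ip f (v D) *\<^sub>R f = u"
  proof (cases "u = 0")
    case False
    have "ip f (v D) = ip f u" using fw by (simp add: u_def ip_simps)
    also have "\<dots> = norm u" using False by (simp add: f_def ip_simps ip_self power2_eq_square)
    finally show ?thesis using False by (simp add: f_def)
  qed (simp add: f_def)
  then have vD: "v D = w + ip f (v D) *\<^sub>R f" by (simp add: u_def)
  have fv: "ip f (v l) = 0" if "l < D" for l
    by (subst rep[OF that]) (simp add: ip_sum ip_simps ef)
  define e' where "e' = e(D := f)"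
  have e'D: "e' D = f" "\<And>i. i < D \<Longrightarrow> e' i = e i" by (auto simp: e'_def)
  have "v l = (\<Sum>i<Suc D. ip (e' i) (v l) *\<^sub>R e' i)" if "l < Suc D" for l
  proof (cases "l = D")
    case True
    then show ?thesis using vD by (simp add: e'D w_def)
  next
    case False
    with that have "l < D" by simp
    with rep[of l] fv[of l] show ?thesis by (simp add: e'D)
  qed
  moreover have "norm (e' i) = 0 \<or> norm (e' i) = 1" if "i < Suc D" for i
    using nrm nf that by (auto simp: e'_def)
  moreover have "ip (e' i) (e' j) = 0" if "i < Suc D" "j < Suc D" "i \<noteq> j" for i j
    using that orth ef by (auto simp: e'_def)
  ultimately show ?case by (intro exI[of _ e']) blast
qed

text \<open>Take the coordinates with respect to an orthonormal family spanning the centres. By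
  orthogonality a combination is no longer than its coefficient vector, and the pairing of
  \<open>z\<close> with a centre sees only the coordinates of \<open>z\<close>.\<close>

lemma hilbert_norming_family:
  fixes c :: "nat \<Rightarrow> 'a"
  obtains \<psi> :: "nat \<Rightarrow> 'a \<Rightarrow>\<^sub>L real" where
    "\<And>x. norm (\<Sum>i<D. x i *\<^sub>R \<psi> i) \<le> sqrt (\<Sum>i<D. (x i)\<^sup>2)"
    "\<And>l z. l < D \<Longrightarrow> norm z \<le> 2 * norm (z - c l) + sqrt (\<Sum>i<D. (blinfun_apply (\<psi> i) z)\<^sup>2)"
proof -
  obtain e where nrm: "\<And>i. i < D \<Longrightarrow> norm (e i) = 0 \<or> norm (e i) = 1"
    and orth: "\<And>i j. i < D \<Longrightarrow> j < D \<Longrightarrow> i \<noteq> j \<Longrightarrow> ip (e i) (e j) = 0"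
    and rep: "\<And>l. l < D \<Longrightarrow> c l = (\<Sum>i<D. ip (e i) (c l) *\<^sub>R e i)"
    using gram_schmidt[of D c] by auto
  define \<psi> where "\<psi> i = Blinfun (ip (e i))" for i
  have bl: "bounded_linear (ip x)" for x
  proof (rule bounded_linear_intro[where K = "norm x"])
    show "norm (ip x y) \<le> norm y * norm x" for y
      using ip_bound[of x y] by (simp add: mult.commute)
  qed (auto simp: ip_simps)
  have ap: "blinfun_apply (\<psi> i) z = ip (e i) z" for i z
    by (simp add: \<psi>_def bounded_linear_Blinfun_apply[OF bl])
  have cs: "\<bar>ip (\<Sum>i<D. x i *\<^sub>R e i) z\<bar> \<le> sqrt (\<Sum>i<D. (x i)\<^sup>2) * norm z" for x z
  proof -
    have "(norm (\<Sum>i<D. x i *\<^sub>R e i))\<^sup>2 \<le> (\<Sum>i<D. (x i)\<^sup>2)"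
      unfolding norm_sum_orthogonal[of D e x, OF orth, simplified]
      by (intro sum_mono) (use nrm in fastforce)
    then have "norm (\<Sum>i<D. x i *\<^sub>R e i) \<le> sqrt (\<Sum>i<D. (x i)\<^sup>2)"
      by (rule real_le_rsqrt)
    with ip_bound[of "\<Sum>i<D. x i *\<^sub>R e i" z] show ?thesis
      by (meson mult_right_mono norm_ge_zero order_trans)
  qed
  show ?thesis
  proof
    fix x :: "nat \<Rightarrow> real"
    show "norm (\<Sum>i<D. x i *\<^sub>R \<psi> i) \<le> sqrt (\<Sum>i<D. (x i)\<^sup>2)"
    proof (rule norm_blinfun_bound)
      fix z
      show "norm (blinfun_apply (\<Sum>i<D. x i *\<^sub>R \<psi> i) z) \<le> sqrt (\<Sum>i<D. (x i)\<^sup>2) * norm z"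
        using cs[of x z] by (simp add: blinfun.sum_left blinfun.scaleR_left ap ip_sum ip_simps)
    qed (simp add: sum_nonneg)
  next
    fix l z assume l: "l < D"
    let ?s = "sqrt (\<Sum>i<D. (ip (e i) z)\<^sup>2)"
    have nc: "(norm (c l))\<^sup>2 = (\<Sum>i<D. (ip (e i) (c l))\<^sup>2)"
    proof -
      have "(norm (c l))\<^sup>2 = (\<Sum>i<D. (ip (e i) (c l))\<^sup>2 * (norm (e i))\<^sup>2)"
        by (subst rep[OF l], rule norm_sum_orthogonal[OF orth])
      also have "\<dots> = (\<Sum>i<D. (ip (e i) (c l))\<^sup>2)"
        by (intro sum.cong refl) (use nrm in \<open>fastforce simp: ip_zero\<close>)
      finally show ?thesis .
    qed
    have "ip (c l) z = (\<Sum>i<D. ip (e i) (c l) * ip (e i) z)"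
      by (subst rep[OF l]) (simp add: ip_sum ip_simps)
    also have "\<dots> \<le> sqrt ((\<Sum>i<D. (ip (e i) (c l))\<^sup>2) * (\<Sum>i<D. (ip (e i) z)\<^sup>2))"
      by (intro real_le_rsqrt Cauchy_Schwarz_ineq_sum)
    also have "\<dots> = norm (c l) * ?s"
      by (simp add: nc[symmetric] real_sqrt_mult)
    finally have 1: "ip (c l) z \<le> norm (c l) * ?s" .
    \<comment> \<open>Both sides are compared with \<open>norm (c l)\<close> times a bound, and one
      factor \<open>norm (c l)\<close> cancels unless it vanishes.\<close>
    have "ip (c l) z = (norm (c l))\<^sup>2 + ip (c l) (z - c l)"
      by (simp add: ip_simps ip_self)
    with ip_bound[of "c l" "z - c l"] 1
    have "norm (c l) * norm (c l) \<le> norm (c l) * (norm (z - c l) + ?s)"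
      by (simp add: power2_eq_square algebra_simps abs_le_iff)
    then have "norm (c l) \<le> norm (z - c l) + ?s"
      using sum_nonneg[of "{..<D}" "\<lambda>i. (ip (e i) z)\<^sup>2"]
      by (cases "norm (c l) = 0") (auto simp: mult_le_cancel_left_pos)
    with norm_triangle_sub[of z "c l"]
    show "norm z \<le> 2 * norm (z - c l) + sqrt (\<Sum>i<D. (blinfun_apply (\<psi> i) z)\<^sup>2)"
      by (simp add: ap)
  qed
qed

end

text \<open>One norming functional per centre. Without orthogonality a combination is only bounded
  by the sum of the absolute coefficients, and Cauchy--Schwarz turns this into \<open>sqrt D\<close>
  times their Euclidean length. The lower bound uses the single functional belonging to the centre
  \<open>c l\<close>.\<close>

lemma banach_norming_family:
  fixes c :: "nat \<Rightarrow> 'a::real_normed_vector"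
  obtains \<psi> :: "nat \<Rightarrow> 'a \<Rightarrow>\<^sub>L real" where
    "\<And>x. norm (\<Sum>i<D. x i *\<^sub>R \<psi> i) \<le> sqrt D * sqrt (\<Sum>i<D. (x i)\<^sup>2)"
    "\<And>l z. l < D \<Longrightarrow> norm z \<le> 2 * norm (z - c l) + sqrt (\<Sum>i<D. (blinfun_apply (\<psi> i) z)\<^sup>2)"
proof -
  have "\<exists>\<phi> :: 'a \<Rightarrow>\<^sub>L real. norm \<phi> \<le> 1 \<and> blinfun_apply \<phi> (c i) = norm (c i)" for i
    using norming_functional[of "c i"] by metis
  then obtain \<psi> :: "nat \<Rightarrow> 'a \<Rightarrow>\<^sub>L real" where
    n: "\<And>i. norm (\<psi> i) \<le> 1" and v: "\<And>i. blinfun_apply (\<psi> i) (c i) = norm (c i)"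
    by metis
  show ?thesis
  proof
    fix x :: "nat \<Rightarrow> real"
    have "norm (\<Sum>i<D. x i *\<^sub>R \<psi> i) \<le> (\<Sum>i<D. \<bar>x i\<bar>)"
      by (intro sum_norm_le) (auto intro: mult_left_le n)
    also have "(\<Sum>i<D. \<bar>x i\<bar>)\<^sup>2 \<le> (\<Sum>i<D. 1) * (\<Sum>i<D. (x i)\<^sup>2)"
      using Cauchy_Schwarz_ineq_sum[of "\<lambda>_. 1" "\<lambda>i. \<bar>x i\<bar>" "{..<D}"] by simp
    then have "(\<Sum>i<D. \<bar>x i\<bar>) \<le> sqrt D * sqrt (\<Sum>i<D. (x i)\<^sup>2)"
      by (simp add: real_le_rsqrt flip: real_sqrt_mult)
    finally show "norm (\<Sum>i<D. x i *\<^sub>R \<psi> i) \<le> sqrt D * sqrt (\<Sum>i<D. (x i)\<^sup>2)" .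
  next
    fix l z assume l: "l < D"
    have "norm (c l) - blinfun_apply (\<psi> l) z \<le> norm (c l - z)"
      using norm_blinfun[of "\<psi> l" "c l - z"] n[of l] mult_right_mono[OF n[of l], of "norm (c l - z)"]
      by (simp add: blinfun.diff_right v)
    moreover have "blinfun_apply (\<psi> l) z \<le> sqrt (\<Sum>i<D. (blinfun_apply (\<psi> i) z)\<^sup>2)"
      using l by (intro real_le_rsqrt member_le_sum) auto
    ultimately show "norm z \<le> 2 * norm (z - c l) + sqrt (\<Sum>i<D. (blinfun_apply (\<psi> i) z)\<^sup>2)"
      using norm_triangle_sub[of z "c l"] norm_minus_commute[of z "c l"] by linarith
  qed
qed

text \<open>
  This is the only place where the exponent \<open>\<alpha>\<close> originates: arbitrary unit functionals cost a
  factor \<open>sqrt D\<close>, which an orthonormal family avoids.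
\<close>

lemma norming_family:
  fixes c :: "nat \<Rightarrow> 'a::banach"
  assumes \<alpha>: "\<alpha> = (if is_hilbert TYPE('a) then 1 / 2 else 1)" and D: "D > 0"
  obtains \<psi> :: "nat \<Rightarrow> 'a \<Rightarrow>\<^sub>L real" where
    "\<And>x. norm (\<Sum>i<D. x i *\<^sub>R \<psi> i) \<le> real D powr (\<alpha> - 1 / 2) * sqrt (\<Sum>i<D. (x i)\<^sup>2)"
    "\<And>l z. l < D \<Longrightarrow> norm z \<le> 2 * norm (z - c l) + sqrt (\<Sum>i<D. (blinfun_apply (\<psi> i) z)\<^sup>2)"
proof (cases "is_hilbert TYPE('a)")
  case True
  then obtain ip :: "'a \<Rightarrow> 'a \<Rightarrow> real" where "hilbert_form ip"
    unfolding is_hilbert_def hilbert_form_def by blast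
  then interpret hilbert_form ip .
  from True \<alpha> have "\<alpha> - 1 / 2 = 0" by simp
  with D have "real D powr (\<alpha> - 1 / 2) = 1" by (simp only:) simp
  moreover obtain \<psi> :: "nat \<Rightarrow> 'a \<Rightarrow>\<^sub>L real" where
    "\<And>x. norm (\<Sum>i<D. x i *\<^sub>R \<psi> i) \<le> sqrt (\<Sum>i<D. (x i)\<^sup>2)"
    "\<And>l z. l < D \<Longrightarrow> norm z \<le> 2 * norm (z - c l) + sqrt (\<Sum>i<D. (blinfun_apply (\<psi> i) z)\<^sup>2)"
    using hilbert_norming_family[of D c] by blast
  ultimately show ?thesis by (intro that[of \<psi>]) simp_all
next
  case False
  with \<alpha> have "real D powr (\<alpha> - 1 / 2) = sqrt D" by (simp add: powr_half_sqrt)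
  moreover obtain \<psi> :: "nat \<Rightarrow> 'a \<Rightarrow>\<^sub>L real" where
    "\<And>x. norm (\<Sum>i<D. x i *\<^sub>R \<psi> i) \<le> sqrt D * sqrt (\<Sum>i<D. (x i)\<^sup>2)"
    "\<And>l z. l < D \<Longrightarrow> norm z \<le> 2 * norm (z - c l) + sqrt (\<Sum>i<D. (blinfun_apply (\<psi> i) z)\<^sup>2)"
    using banach_norming_family[of D c] by blast
  ultimately show ?thesis by (intro that[of \<psi>]) simp_all
qed

section \<open>Sequences of independent normal variables\<close>

text \<open>Tychonoff's theorem for the topology of the function type. It gives compactness of the
  set of clipped sequences and of the support of the random maps.\<close>

lemma compact_PiE_UNIV:
  fixes S :: "'i \<Rightarrow> 'b::topological_space set"
  assumes "\<And>i. compact (S i)"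
  shows "compact (PiE UNIV S)"
  using assms compactin_PiE[of "\<lambda>_. euclidean" UNIV S]
  by (simp add: euclidean_product_topology compactin_euclidean_iff)

definition std_normal :: "real measure" where
  "std_normal = density lborel std_normal_density"

definition gauss_seq :: "('i \<Rightarrow> real) measure" where
  "gauss_seq = PiM UNIV (\<lambda>_. std_normal)"

lemma sets_std_normal [simp, measurable_cong]: "sets std_normal = sets borel"
  by (simp add: std_normal_def)

lemma space_std_normal [simp]: "space std_normal = UNIV"
  by (simp add: std_normal_def)

lemma prob_space_std_normal: "prob_space std_normal"
  unfolding std_normal_def by (rule prob_space_normal_density) simp

text \<open>Countability of the index type makes the product sigma-algebra the Borel one, so that
  continuity implies measurability.\<close>

lemma sets_gauss_seq [measurable_cong]:
  "sets (gauss_seq :: ('i::countable \<Rightarrow> real) measure) = sets borel"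
  unfolding gauss_seq_def
  by (subst sets_PiM_equal_borel[symmetric]) (rule sets_PiM_cong, auto)

lemma space_gauss_seq [simp]: "space gauss_seq = UNIV"
  by (auto simp: gauss_seq_def space_PiM)

lemma prob_space_gauss_seq: "prob_space (gauss_seq :: ('i \<Rightarrow> real) measure)"
  unfolding gauss_seq_def by (rule prob_space_PiM) (rule prob_space_std_normal)

interpretation gauss_seq: prob_space "gauss_seq :: ('i \<Rightarrow> real) measure"
  by (rule prob_space_gauss_seq)

lemma distr_gauss_seq_component: "distr gauss_seq std_normal (\<lambda>\<xi>. \<xi> i) = std_normal"
  unfolding gauss_seq_def by (rule distr_PiM_component) (auto simp: prob_space_std_normal)

lemma measurable_gauss_seq_component [measurable]: "(\<lambda>\<xi>. \<xi> i) \<in> measurable gauss_seq std_normal"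
  unfolding gauss_seq_def by simp

lemma indep_vars_gauss_seq:
  "gauss_seq.indep_vars (\<lambda>_. std_normal) (\<lambda>i \<xi>. \<xi> i) (UNIV :: 'i set)"
proof (subst gauss_seq.indep_vars_iff_distr_eq_PiM)
  have "distr gauss_seq (PiM UNIV (\<lambda>i::'i. std_normal)) (\<lambda>x. \<lambda>i\<in>UNIV. x i) = gauss_seq"
    by (simp add: gauss_seq_def restrict_UNIV)
  then show "distr gauss_seq (PiM UNIV (\<lambda>i::'i. std_normal)) (\<lambda>x. \<lambda>i\<in>UNIV. x i)
      = PiM UNIV (\<lambda>i::'i. distr gauss_seq std_normal (\<lambda>\<xi>. \<xi> i))"
    by (simp add: distr_gauss_seq_component) (simp add: gauss_seq_def)
qed auto

lemma distributed_gauss_seq_component: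
  "distributed gauss_seq lborel (\<lambda>\<xi>. \<xi> i) std_normal_density"
  unfolding distributed_def
proof safe
  have "distr gauss_seq lborel (\<lambda>\<xi>. \<xi> i) = distr gauss_seq std_normal (\<lambda>\<xi>. \<xi> i)"
    by (rule distr_cong) auto
  then show "distr gauss_seq lborel (\<lambda>\<xi>. \<xi> i) = density lborel std_normal_density"
    by (simp add: distr_gauss_seq_component) (simp add: std_normal_def)
  show "(\<lambda>\<xi>. \<xi> i) \<in> measurable gauss_seq lborel"
    using measurable_gauss_seq_component[of i] by (simp cong: measurable_cong_sets)
qed auto

lemma indep_vars_gauss_seq':
  "gauss_seq.indep_vars (\<lambda>_. borel) (\<lambda>i \<xi>. a i * \<xi> i) (I :: 'i set)"
proof -
  have "gauss_seq.indep_vars (\<lambda>_. borel) (\<lambda>i. (\<lambda>x. a i * x) \<circ> (\<lambda>\<xi>. \<xi> i)) I"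
    by (rule gauss_seq.indep_vars_compose[OF gauss_seq.indep_vars_subset[OF indep_vars_gauss_seq]]) auto
  then show ?thesis by (simp add: o_def)
qed

section \<open>Finite linear combinations of the variables: law, small balls and tails\<close>

lemma distributed_gauss_seq_sum:
  assumes J: "finite J" "\<exists>i\<in>J. a i \<noteq> 0"
  shows "distributed gauss_seq lborel (\<lambda>\<xi>. \<Sum>i\<in>J. a i * \<xi> i)
    (normal_density 0 (sqrt (\<Sum>i\<in>J. (a i)\<^sup>2)))"
proof -
  \<comment> \<open>Vanishing coefficients are dropped, because a summand of variance zero has no
    density.\<close>
  define J' where "J' = {i\<in>J. a i \<noteq> 0}"
  have "distributed gauss_seq lborel (\<lambda>\<xi>. a i * \<xi> i) (normal_density 0 \<bar>a i\<bar>)" if "i \<in> J'" for i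
    using gauss_seq.normal_density_affine[OF distributed_gauss_seq_component[of i], of "a i" 0] that
    by (simp add: J'_def)
  then have "distributed gauss_seq lborel (\<lambda>\<xi>. \<Sum>i\<in>J'. a i * \<xi> i)
    (normal_density (\<Sum>i\<in>J'. 0) (sqrt (\<Sum>i\<in>J'. \<bar>a i\<bar>\<^sup>2)))"
    by (intro gauss_seq.sum_indep_normal indep_vars_gauss_seq') (use J in \<open>auto simp: J'_def\<close>)
  moreover have "(\<Sum>i\<in>J'. a i * \<xi> i) = (\<Sum>i\<in>J. a i * \<xi> i)" for \<xi>
    unfolding J'_def using J by (intro sum.mono_neutral_left) auto
  moreover have "(\<Sum>i\<in>J'. \<bar>a i\<bar>\<^sup>2) = (\<Sum>i\<in>J. (a i)\<^sup>2)"
    unfolding J'_def using J by (simp only: power2_abs, intro sum.mono_neutral_left) auto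
  ultimately show ?thesis by simp
qed

text \<open>The density never exceeds \<open>1 / (2 * \<sigma>)\<close>, as
  \<open>sqrt (2 * pi)\<close> is at least 2, and the interval has length
  \<open>2 * \<epsilon>\<close>. Uniformity in \<open>u\<close> is what later makes translations
  harmless.\<close>

lemma normal_density_interval:
  assumes \<sigma>: "\<sigma> > 0" and \<epsilon>: "\<epsilon> \<ge> 0"
  shows "emeasure (density lborel (normal_density 0 \<sigma>)) {y. \<bar>u + y\<bar> < \<epsilon>} \<le> ennreal (\<epsilon> / \<sigma>)"
proof -
  have le: "normal_density 0 \<sigma> y \<le> 1 / (2 * \<sigma>)" for y
  proof -
    have "exp (- (y - 0)\<^sup>2 / (2 * \<sigma>\<^sup>2)) \<le> 1" by simp
    then have "normal_density 0 \<sigma> y \<le> 1 / sqrt (2 * pi * \<sigma>\<^sup>2)"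
      unfolding normal_density_def by (intro mult_left_le) auto
    also have "2 * \<sigma> \<le> sqrt (2 * pi * \<sigma>\<^sup>2)"
      using pi_ge_two \<sigma> by (intro real_le_rsqrt) (auto simp: power2_eq_square mult_right_mono)
    then have "1 / sqrt (2 * pi * \<sigma>\<^sup>2) \<le> 1 / (2 * \<sigma>)"
      using \<sigma> by (intro frac_le) auto
    finally show ?thesis .
  qed
  have "{y. \<bar>u + y\<bar> < \<epsilon>} = {- u - \<epsilon><..<- u + \<epsilon>}" by (auto simp: abs_less_iff)
  then have "emeasure (density lborel (normal_density 0 \<sigma>)) {y. \<bar>u + y\<bar> < \<epsilon>}
      = (\<integral>\<^sup>+y. ennreal (normal_density 0 \<sigma> y) * indicator {- u - \<epsilon><..<- u + \<epsilon>} y \<partial>lborel)"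
    by (simp add: emeasure_density)
  also have "\<dots> \<le> (\<integral>\<^sup>+y. ennreal (1 / (2 * \<sigma>)) * indicator {- u - \<epsilon><..<- u + \<epsilon>} y \<partial>lborel)"
    by (intro nn_integral_mono mult_right_mono ennreal_leI le) auto
  also have "\<dots> = ennreal (1 / (2 * \<sigma>)) * ennreal (2 * \<epsilon>)"
    using \<epsilon> by (simp add: nn_integral_cmult_indicator)
  also have "\<dots> = ennreal (\<epsilon> / \<sigma>)"
    using \<sigma> \<epsilon> by (simp add: ennreal_mult[symmetric])
  finally show ?thesis .
qed

text \<open>By \<open>Uind\<close> the shift \<open>U\<close> is independent of the sum over
  \<open>J\<close>. Fubini's theorem therefore reduces the claim to a deterministic shift.\<close>

lemma gauss_seq_small_ball:
  fixes U :: "('i::countable \<Rightarrow> real) \<Rightarrow> real"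
  assumes J: "finite J" and \<sigma>: "sqrt (\<Sum>i\<in>J. (a i)\<^sup>2) > 0" and \<epsilon>: "\<epsilon> \<ge> 0"
    and U [measurable]: "U \<in> borel_measurable gauss_seq"
    and Uind: "\<And>\<xi> \<eta>. (\<And>i. i \<notin> J \<Longrightarrow> \<xi> i = \<eta> i) \<Longrightarrow> U \<xi> = U \<eta>"
  shows "emeasure gauss_seq {\<xi>. \<bar>U \<xi> + (\<Sum>i\<in>J. a i * \<xi> i)\<bar> < \<epsilon>}
    \<le> ennreal (\<epsilon> / sqrt (\<Sum>i\<in>J. (a i)\<^sup>2))"
proof -
  let ?\<sigma> = "sqrt (\<Sum>i\<in>J. (a i)\<^sup>2)"
  define Y where "Y \<xi> = (\<Sum>i\<in>J. a i * \<xi> i)" for \<xi>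
  \<comment> \<open>Padding with zeros on \<open>J\<close> lets \<open>U\<close> factor through the
    restriction to the complement of \<open>J\<close>.\<close>
  define ext where "ext \<eta> = (\<lambda>i. if i \<in> J then 0 else \<eta> i)" for \<eta> :: "'i \<Rightarrow> real"
  have ex: "\<exists>i\<in>J. a i \<noteq> 0"
  proof (rule ccontr)
    assume "\<not> (\<exists>i\<in>J. a i \<noteq> 0)"
    then show False using \<sigma> by simp
  qed
  have D: "distributed gauss_seq lborel Y (normal_density 0 ?\<sigma>)"
    using distributed_gauss_seq_sum[OF J ex] by (simp add: Y_def[abs_def])
  then have Ym [measurable]: "Y \<in> borel_measurable gauss_seq"
    by (simp add: distributed_def measurable_lborel1)
  have "(\<lambda>\<eta>. U (ext \<eta>)) \<in> borel_measurable (PiM (- J) (\<lambda>_. std_normal))"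
  proof (rule measurable_compose[OF _ U])
    show "ext \<in> measurable (PiM (- J) (\<lambda>_. std_normal)) gauss_seq"
      unfolding gauss_seq_def
    proof (rule measurable_PiM_single')
      fix i show "(\<lambda>\<eta>. ext \<eta> i) \<in> measurable (PiM (- J) (\<lambda>_. std_normal)) std_normal"
        by (cases "i \<in> J") (auto simp: ext_def)
    qed (auto simp: space_PiM)
  qed
  moreover have "(\<lambda>\<eta>. \<Sum>i\<in>J. a i * \<eta> i) \<in> borel_measurable (PiM J (\<lambda>_. std_normal))"
    by (rule borel_measurable_sum) (auto intro!: borel_measurable_times intro: measurable_compose[OF measurable_component_singleton])
  ultimately have "gauss_seq.indep_var borel ((\<lambda>\<eta>. U (ext \<eta>)) \<circ> (\<lambda>\<xi>. restrict (\<lambda>i. \<xi> i) (- J)))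
      borel ((\<lambda>\<eta>. \<Sum>i\<in>J. a i * \<eta> i) \<circ> (\<lambda>\<xi>. restrict (\<lambda>i. \<xi> i) J))"
    by (intro gauss_seq.indep_var_compose[OF gauss_seq.indep_var_restrict[OF indep_vars_gauss_seq]]) auto
  also have "(\<lambda>\<eta>. U (ext \<eta>)) \<circ> (\<lambda>\<xi>. restrict (\<lambda>i. \<xi> i) (- J)) = U"
    by (intro ext) (auto simp: ext_def intro!: Uind)
  also have "(\<lambda>\<eta>. \<Sum>i\<in>J. a i * \<eta> i) \<circ> (\<lambda>\<xi>. restrict (\<lambda>i. \<xi> i) J) = Y"
    by (auto simp: Y_def fun_eq_iff)
  finally have ind: "gauss_seq.indep_var borel U borel Y" .
  have dY: "distr gauss_seq borel Y = density lborel (normal_density 0 ?\<sigma>)"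
    using D by (simp add: distributed_def cong: distr_cong)
  let ?A = "{p :: real \<times> real. \<bar>fst p + snd p\<bar> < \<epsilon>}"
  have A [measurable]: "?A \<in> sets (borel \<Otimes>\<^sub>M borel)"
  proof -
    have "{p \<in> space (borel \<Otimes>\<^sub>M borel). \<bar>fst p + snd p\<bar> < \<epsilon>} \<in> sets (borel \<Otimes>\<^sub>M borel)"
      by measurable
    then show ?thesis by (simp add: space_pair_measure)
  qed
  interpret dU: prob_space "distr gauss_seq borel U"
    by (rule gauss_seq.prob_space_distr) measurable
  interpret dY: prob_space "distr gauss_seq borel Y"
    by (rule gauss_seq.prob_space_distr) measurable
  have "{\<xi>. \<bar>U \<xi> + Y \<xi>\<bar> < \<epsilon>} = (\<lambda>\<xi>. (U \<xi>, Y \<xi>)) -` ?A \<inter> space gauss_seq" by auto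
  then have "emeasure gauss_seq {\<xi>. \<bar>U \<xi> + Y \<xi>\<bar> < \<epsilon>}
      = emeasure (distr gauss_seq (borel \<Otimes>\<^sub>M borel) (\<lambda>\<xi>. (U \<xi>, Y \<xi>))) ?A"
    by (simp add: emeasure_distr)
  also have "\<dots> = emeasure (distr gauss_seq borel U \<Otimes>\<^sub>M distr gauss_seq borel Y) ?A"
    using ind by (simp add: gauss_seq.indep_var_distribution_eq)
  also have "\<dots> = (\<integral>\<^sup>+u. emeasure (distr gauss_seq borel Y) (Pair u -` ?A) \<partial>distr gauss_seq borel U)"
    by (rule dY.emeasure_pair_measure_alt) simp
  also have "\<dots> \<le> (\<integral>\<^sup>+u. ennreal (\<epsilon> / ?\<sigma>) \<partial>distr gauss_seq borel U)"
    using normal_density_interval[OF \<sigma> \<epsilon>]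
    by (intro nn_integral_mono) (simp add: dY vimage_def)
  also have "\<dots> = ennreal (\<epsilon> / ?\<sigma>)"
    using dU.emeasure_space_1 by simp
  finally show ?thesis by (simp add: Y_def)
qed

text \<open>Markov's inequality, each square having expectation 1. This polynomial tail is enough,
  since it is used with \<open>r\<close> larger than the number of variables by a geometrically
  growing factor.\<close>

lemma gauss_seq_square_tail:
  fixes J :: "'i::countable set"
  assumes J: "finite J" and r: "r > 0"
  shows "emeasure gauss_seq {\<xi>. (\<Sum>i\<in>J. (\<xi> i)\<^sup>2) > r} \<le> ennreal (card J / r)"
proof -
  have 1: "(\<integral>\<^sup>+\<xi>. ennreal ((\<xi> i)\<^sup>2) \<partial>gauss_seq) = 1" for i :: 'i
  proof -
    have "(\<integral>\<^sup>+\<xi>. ennreal ((\<xi> i)\<^sup>2) \<partial>gauss_seq)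
        = (\<integral>\<^sup>+x. ennreal (std_normal_density x) * ennreal (x\<^sup>2) \<partial>lborel)"
      using distributed_nn_integral[OF distributed_gauss_seq_component[of i], of "\<lambda>x. ennreal (x\<^sup>2)"] by simp
    also have "\<dots> = (\<integral>\<^sup>+x. ennreal (std_normal_density x * x ^ (2 * 1)) \<partial>lborel)"
      by (intro nn_integral_cong) (simp add: ennreal_mult)
    also have "\<dots> = ennreal (fact (2 * 1) / (2 ^ 1 * fact 1))"
      using std_normal_moment_even[of 1]
      by (intro nn_integral_eq_integral[of lborel, THEN trans])
        (auto simp: has_bochner_integral_iff)
    finally show ?thesis by simp
  qed
  have m: "(\<lambda>\<xi> :: 'i \<Rightarrow> real. \<Sum>i\<in>J. (\<xi> i)\<^sup>2) \<in> borel_measurable gauss_seq" by measurable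
  have "emeasure gauss_seq {\<xi>. (\<Sum>i\<in>J. (\<xi> i)\<^sup>2) > r}
      \<le> emeasure gauss_seq {\<xi>\<in>space gauss_seq. 1 \<le> ennreal (1 / r) * ennreal (\<Sum>i\<in>J. (\<xi> i)\<^sup>2)}"
    using r m by (intro emeasure_mono) (auto simp: ennreal_mult[symmetric] sum_nonneg field_simps
        simp flip: ennreal_1)
  also have "\<dots> \<le> ennreal (1 / r) * (\<integral>\<^sup>+\<xi>. ennreal (\<Sum>i\<in>J. (\<xi> i)\<^sup>2) * indicator (space gauss_seq) \<xi> \<partial>gauss_seq)"
    using m by (intro nn_integral_Markov_inequality) auto
  also have "(\<integral>\<^sup>+\<xi>. ennreal (\<Sum>i\<in>J. (\<xi> i)\<^sup>2) * indicator (space gauss_seq) \<xi> \<partial>gauss_seq)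
      = (\<integral>\<^sup>+\<xi>. (\<Sum>i\<in>J. ennreal ((\<xi> i)\<^sup>2)) \<partial>gauss_seq)"
    by (intro nn_integral_cong) simp
  also have "\<dots> = (\<Sum>i\<in>J. (\<integral>\<^sup>+\<xi>. ennreal ((\<xi> i)\<^sup>2) \<partial>gauss_seq))"
    by (rule nn_integral_sum) measurable
  also have "\<dots> = ennreal (card J)" by (simp add: 1 ennreal_of_nat_eq_real_of_nat)
  also have "ennreal (1 / r) * ennreal (card J) = ennreal (card J / r)"
    using r by (simp add: ennreal_mult[symmetric])
  finally show ?thesis .
qed

section \<open>Random functionals\<close>

text \<open>Weights are absorbed into \<open>\<psi>\<close>. Here \<open>D k\<close> counts the
  functionals of block \<open>k\<close>, and \<open>A k * r k\<close> bounds the norm of that block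
  once its coefficient vector is cut down to length \<open>r k\<close>.\<close>

locale random_functional =
  fixes \<psi> :: "nat \<Rightarrow> nat \<Rightarrow> 'a::real_normed_vector \<Rightarrow>\<^sub>L real"
    and D :: "nat \<Rightarrow> nat" and A r :: "nat \<Rightarrow> real"
  assumes r_pos: "r k > 0" and A_nonneg: "A k \<ge> 0"
    and bound: "norm (\<Sum>i<D k. x i *\<^sub>R \<psi> k i) \<le> A k * sqrt (\<Sum>i<D k. (x i)\<^sup>2)"
    and summable: "summable (\<lambda>k. A k * r k)"
begin

definition energy :: "nat \<Rightarrow> (nat \<times> nat \<Rightarrow> real) \<Rightarrow> real" where
  "energy k \<xi> = sqrt (\<Sum>i<D k. (\<xi> (k, i))\<^sup>2)"

text \<open>
  Clipping makes the random series converge everywhere and take values in a compact set, and it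
  almost surely leaves all but finitely many blocks alone. A conditioned measure is thus not needed.
\<close>

definition clip :: "(nat \<times> nat \<Rightarrow> real) \<Rightarrow> nat \<times> nat \<Rightarrow> real" where
  "clip \<xi> p = (if snd p < D (fst p) then \<xi> p / max 1 (energy (fst p) \<xi> / r (fst p)) else 0)"

definition clipped :: "(nat \<times> nat \<Rightarrow> real) set" where
  "clipped = {y. \<forall>k. energy k y \<le> r k \<and> (\<forall>i\<ge>D k. y (k, i) = 0)}"

definition block :: "nat \<Rightarrow> (nat \<times> nat \<Rightarrow> real) \<Rightarrow> 'a \<Rightarrow>\<^sub>L real" where
  "block k y = (\<Sum>i<D k. y (k, i) *\<^sub>R \<psi> k i)"

definition F :: "(nat \<times> nat \<Rightarrow> real) \<Rightarrow> 'a \<Rightarrow>\<^sub>L real" where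
  "F \<xi> = (\<Sum>k. block k (clip \<xi>))"

lemma energy_scale: "energy k (\<lambda>p. \<xi> p / t) = energy k \<xi> / \<bar>t\<bar>"
  by (simp add: energy_def power_divide real_sqrt_divide flip: sum_divide_distrib)

lemma energy_clip: "energy k (clip \<xi>) = energy k \<xi> / max 1 (energy k \<xi> / r k)"
proof -
  have "energy k (clip \<xi>) = energy k (\<lambda>p. \<xi> p / max 1 (energy k \<xi> / r k))"
    unfolding energy_def[of k "clip \<xi>"] energy_def[of k "\<lambda>p. \<xi> p / max 1 (energy k \<xi> / r k)"]
    by (simp add: clip_def)
  then show ?thesis by (simp add: energy_scale)
qed

lemma clip_in_clipped: "clip \<xi> \<in> clipped"
proof -
  have "energy k (clip \<xi>) \<le> r k" for k
  proof -
    have "energy k \<xi> = r k * (energy k \<xi> / r k)" using r_pos[of k] by simp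
    also have "\<dots> \<le> r k * max 1 (energy k \<xi> / r k)"
      using r_pos[of k] by (intro mult_left_mono) auto
    finally show ?thesis unfolding energy_clip by (simp add: pos_divide_le_eq)
  qed
  then show ?thesis by (simp add: clipped_def) (simp add: clip_def)
qed

lemma continuous_energy: "continuous_on S (energy k)"
  unfolding energy_def by (intro continuous_intros continuous_on_subset[OF continuous_on_product_coordinates]) auto

lemma continuous_clip: "continuous_on UNIV clip"
proof (rule continuous_on_coordinatewise_then_product)
  fix p :: "nat \<times> nat"
  have "max 1 x \<noteq> (0::real)" for x by (simp add: max_def)
  then have "continuous_on UNIV (\<lambda>\<xi>. \<xi> p / max 1 (energy (fst p) \<xi> / r (fst p)))"
    using r_pos[of "fst p"]
    by (intro continuous_intros continuous_energy) auto
  then show "continuous_on UNIV (\<lambda>\<xi>. clip \<xi> p)"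
    unfolding clip_def by (cases "snd p < D (fst p)") simp_all
qed

text \<open>A coordinate inside a block is bounded by the energy of the block, and the coordinates
  beyond \<open>D k\<close> are pinned to zero. The set is thus a closed part of a product of
  compact intervals.\<close>

lemma compact_clipped: "compact clipped"
proof -
  let ?B = "PiE UNIV (\<lambda>p. {- r (fst p)..r (fst p)}) :: (nat \<times> nat \<Rightarrow> real) set"
  have "clipped = (\<Inter>k. {y. energy k y \<le> r k}) \<inter> (\<Inter>k. \<Inter>i\<in>{D k..}. {y. y (k, i) = 0})"
    by (auto simp: clipped_def)
  also have "closed \<dots>"
    by (intro closed_Int closed_INT ballI closed_Collect_le closed_Collect_eq continuous_energy) auto
  finally have "closed clipped" .
  moreover have "compact ?B" by (rule compact_PiE_UNIV) simp
  ultimately have "compact (clipped \<inter> ?B)" by (rule closed_Int_compact)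
  moreover have "clipped \<subseteq> ?B"
  proof
    fix y assume y: "y \<in> clipped"
    have "\<bar>y (k, i)\<bar> \<le> r k" for k i
    proof (cases "i < D k")
      case True
      then have "(y (k, i))\<^sup>2 \<le> (\<Sum>i<D k. (y (k, i))\<^sup>2)" by (intro member_le_sum) auto
      then have "\<bar>y (k, i)\<bar> \<le> energy k y" unfolding energy_def by (metis real_sqrt_abs real_sqrt_le_iff)
      also have "\<dots> \<le> r k" using y by (simp add: clipped_def)
      finally show ?thesis .
    next
      case False
      with y show ?thesis using r_pos[of k] by (simp add: clipped_def less_imp_le)
    qed
    then show "y \<in> ?B" by (auto simp: abs_le_iff) (metis minus_le_iff)
  qed
  ultimately show ?thesis by (simp add: Int_absorb2)
qed

lemma norm_block: "norm (block k y) \<le> A k * energy k y"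
  unfolding block_def energy_def by (rule bound)

lemma norm_block_clipped: "y \<in> clipped \<Longrightarrow> norm (block k y) \<le> A k * r k"
  by (rule order_trans[OF norm_block]) (simp add: mult_left_mono A_nonneg clipped_def)

lemma summable_block: "y \<in> clipped \<Longrightarrow> summable (\<lambda>k. block k y)"
  by (rule summable_comparison_test'[OF summable, of 0]) (simp add: norm_block_clipped)

lemma continuous_sum_block: "continuous_on clipped (\<lambda>y. \<Sum>k. block k y)"
proof (rule uniform_limit_theorem)
  show "uniform_limit clipped (\<lambda>n y. \<Sum>k<n. block k y) (\<lambda>y. \<Sum>k. block k y) sequentially"
    by (rule Weierstrass_m_test[OF norm_block_clipped summable])
  have "continuous_on clipped (\<lambda>y. y (k, i))" for k i
    by (rule continuous_on_subset[OF continuous_on_product_coordinates]) simp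
  then show "\<forall>\<^sub>F n in sequentially. continuous_on clipped (\<lambda>y. \<Sum>k<n. block k y)"
    unfolding block_def by (intro always_eventually allI continuous_intros)
qed simp

lemma continuous_F: "continuous_on UNIV F"
proof -
  have "continuous_on UNIV ((\<lambda>y. \<Sum>k. block k y) \<circ> clip)"
    by (intro continuous_on_compose continuous_clip continuous_on_subset[OF continuous_sum_block])
      (auto simp: clip_in_clipped)
  then show ?thesis by (simp add: o_def F_def[abs_def])
qed

definition F_hull :: "('a \<Rightarrow>\<^sub>L real) set" where
  "F_hull = (\<lambda>y. \<Sum>k. block k y) ` clipped"

lemma compact_F_hull: "compact F_hull"
  unfolding F_hull_def by (rule compact_continuous_image[OF continuous_sum_block compact_clipped])

lemma F_in_hull: "F \<xi> \<in> F_hull"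
  using clip_in_clipped by (auto simp: F_hull_def F_def)

section \<open>Dependence of the random functional on a single block\<close>

definition zero_block :: "nat \<Rightarrow> (nat \<times> nat \<Rightarrow> real) \<Rightarrow> nat \<times> nat \<Rightarrow> real" where
  "zero_block k \<xi> p = (if fst p = k then 0 else \<xi> p)"

text \<open>Where block \<open>k\<close> is not clipped, \<open>F\<close> is affine in it, with a
  constant term determined by the other blocks. This is the form to which the Gaussian small-ball
  estimate applies.\<close>

lemma F_split:
  assumes "energy k \<xi> \<le> r k"
  shows "F \<xi> = F (zero_block k \<xi>) + block k \<xi>"
proof -
  have e: "energy l (zero_block k \<xi>) = (if l = k then 0 else energy l \<xi>)" for l
    by (simp add: energy_def zero_block_def)
  have c: "block l (clip \<xi>) = block l (clip (zero_block k \<xi>)) + (if l = k then block k \<xi> else 0)" for l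
  proof (cases "l = k")
    case True
    have "max 1 (energy k \<xi> / r k) = 1" using assms r_pos[of k] by (simp add: max_def)
    then show ?thesis using True
      by (simp add: block_def clip_def zero_block_def)
  next
    case False
    then show ?thesis by (simp add: block_def clip_def e) (simp add: zero_block_def)
  qed
  have "(\<lambda>l. block l (clip (zero_block k \<xi>)) + (if l = k then block k \<xi> else 0))
      sums (F (zero_block k \<xi>) + block k \<xi>)"
    unfolding F_def
    by (intro sums_add summable_sums summable_block clip_in_clipped) (rule sums_single)
  then show ?thesis unfolding F_def[of \<xi>] c by (rule sums_unique[symmetric])
qed

text \<open>The other blocks and \<open>w\<close> together act as a shift independent of block
  \<open>k\<close>. Restricting to the event that block \<open>k\<close> is not clipped allows
  \<open>F_split\<close> to be applied.\<close>

lemma small_ball: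
  assumes \<sigma>: "sqrt (\<Sum>i<D k. (blinfun_apply (\<psi> k i) c)\<^sup>2) > 0" and \<epsilon>: "\<epsilon> \<ge> 0"
  shows "emeasure gauss_seq {\<xi>. energy k \<xi> \<le> r k \<and> \<bar>w + blinfun_apply (F \<xi>) c\<bar> < \<epsilon>}
    \<le> ennreal (\<epsilon> / sqrt (\<Sum>i<D k. (blinfun_apply (\<psi> k i) c)\<^sup>2))"
proof -
  let ?J = "Pair k ` {..<D k}"
  let ?a = "\<lambda>p. blinfun_apply (\<psi> k (snd p)) c"
  define U where "U \<xi> = w + blinfun_apply (F (zero_block k \<xi>)) c" for \<xi>
  have zb: "continuous_on UNIV (zero_block k)"
    unfolding zero_block_def[abs_def]
  proof (rule continuous_on_coordinatewise_then_product)
    show "continuous_on UNIV (\<lambda>\<xi>. if fst p = k then 0 else (\<xi> p :: real))" for p :: "nat \<times> nat"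
      by (cases "fst p = k") simp_all
  qed
  have "continuous_on UNIV (\<lambda>\<xi>. F (zero_block k \<xi>))"
    using continuous_on_compose[OF zb continuous_on_subset[OF continuous_F]] by (simp add: o_def)
  then have "continuous_on UNIV U" unfolding U_def by (intro continuous_intros)
  then have Um: "U \<in> borel_measurable gauss_seq"
    by (subst measurable_cong_sets[OF sets_gauss_seq refl]) (rule borel_measurable_continuous_onI)
  have s: "(\<Sum>i\<in>?J. f i) = (\<Sum>i<D k. f (k, i))" for f :: "nat \<times> nat \<Rightarrow> real"
    by (subst sum.reindex) (auto simp: inj_on_def)
  have z: "zero_block k \<xi> = zero_block k \<eta>" if "\<And>p. p \<notin> ?J \<Longrightarrow> \<xi> p = \<eta> p" for \<xi> \<eta>
    using that by (force simp: zero_block_def fun_eq_iff)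
  have m: "{\<xi>. \<bar>U \<xi> + (\<Sum>p\<in>?J. ?a p * \<xi> p)\<bar> < \<epsilon>} \<in> sets gauss_seq"
  proof -
    have "continuous_on UNIV (\<lambda>\<xi>. \<bar>U \<xi> + (\<Sum>p\<in>?J. ?a p * \<xi> p)\<bar>)"
      using \<open>continuous_on UNIV U\<close> by (intro continuous_intros) auto
    from open_Collect_less[OF this continuous_on_const] show ?thesis by (simp add: sets_gauss_seq)
  qed
  have "emeasure gauss_seq {\<xi>. energy k \<xi> \<le> r k \<and> \<bar>w + blinfun_apply (F \<xi>) c\<bar> < \<epsilon>}
      \<le> emeasure gauss_seq {\<xi>. \<bar>U \<xi> + (\<Sum>p\<in>?J. ?a p * \<xi> p)\<bar> < \<epsilon>}"
  proof (rule emeasure_mono[OF _ m], safe)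
    fix \<xi> assume "energy k \<xi> \<le> r k" "\<bar>w + blinfun_apply (F \<xi>) c\<bar> < \<epsilon>"
    moreover have "blinfun_apply (block k \<xi>) c = (\<Sum>p\<in>?J. ?a p * \<xi> p)"
      by (simp add: s block_def blinfun.sum_left blinfun.scaleR_left mult.commute)
    ultimately show "\<bar>U \<xi> + (\<Sum>p\<in>?J. ?a p * \<xi> p)\<bar> < \<epsilon>"
      by (simp add: U_def F_split blinfun.add_left add.assoc)
  qed
  also have "\<dots> \<le> ennreal (\<epsilon> / sqrt (\<Sum>p\<in>?J. (?a p)\<^sup>2))"
  proof (rule gauss_seq_small_ball[OF _ _ \<epsilon> Um])
    fix \<xi> \<eta> :: "nat \<times> nat \<Rightarrow> real" assume "\<And>p. p \<notin> ?J \<Longrightarrow> \<xi> p = \<eta> p"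
    then have "zero_block k \<xi> = zero_block k \<eta>" by (rule z)
    then show "U \<xi> = U \<eta>" by (simp only: U_def)
  next
    show "0 < sqrt (\<Sum>p\<in>?J. (?a p)\<^sup>2)" using \<sigma> by (simp only: s snd_conv)
  qed simp
  finally show ?thesis by (simp add: s)
qed

lemma energy_tail: "emeasure gauss_seq {\<xi>. energy k \<xi> > r k} \<le> ennreal (D k / (r k)\<^sup>2)"
proof -
  have s: "(\<Sum>p\<in>Pair k ` {..<D k}. (\<xi> p)\<^sup>2) = (\<Sum>i<D k. (\<xi> (k, i))\<^sup>2)" for \<xi> :: "nat \<times> nat \<Rightarrow> real"
    by (subst sum.reindex) (auto simp: inj_on_def)
  have "energy k \<xi> > r k \<longleftrightarrow> (\<Sum>p\<in>Pair k ` {..<D k}. (\<xi> p)\<^sup>2) > (r k)\<^sup>2" for \<xi>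
    unfolding energy_def s using r_pos[of k]
    by (metis less_eq_real_def real_less_rsqrt real_sqrt_less_iff real_sqrt_unique)
  then show ?thesis
    using gauss_seq_square_tail[of "Pair k ` {..<D k}" "(r k)\<^sup>2"] r_pos[of k]
    by (simp add: card_image inj_on_def)
qed

end

section \<open>Random linear maps and prevalence\<close>

lemma prod_mono_ennreal:
  fixes f g :: "'b \<Rightarrow> ennreal"
  assumes "\<And>j. j \<in> J \<Longrightarrow> f j \<le> g j"
  shows "(\<Prod>j\<in>J. f j) \<le> (\<Prod>j\<in>J. g j)"
  using assms by (induction J rule: infinite_finite_induct) (auto intro!: mult_mono)

definition gauss_vec :: "('n::finite \<Rightarrow> 'i::countable \<Rightarrow> real) measure" where
  "gauss_vec = PiM UNIV (\<lambda>_. gauss_seq)"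

lemma sets_gauss_vec [measurable_cong]:
  "sets (gauss_vec :: ('n::finite \<Rightarrow> 'i::countable \<Rightarrow> real) measure) = sets borel"
  unfolding gauss_vec_def
  by (subst sets_PiM_equal_borel[symmetric]) (rule sets_PiM_cong, auto simp: sets_gauss_seq)

lemma space_gauss_vec [simp]: "space gauss_vec = UNIV"
  by (auto simp: gauss_vec_def space_PiM)

lemma prob_space_gauss_vec: "prob_space (gauss_vec :: ('n::finite \<Rightarrow> 'i::countable \<Rightarrow> real) measure)"
  unfolding gauss_vec_def by (rule prob_space_PiM) (rule prob_space_gauss_seq)

text \<open>Independence of the coordinates, from which the small-ball estimate gains its exponent,
  the dimension of the target.\<close>

lemma emeasure_gauss_vec_all:
  assumes "\<And>j :: 'n. B j \<in> sets (gauss_seq :: ('i::countable \<Rightarrow> real) measure)"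
  shows "emeasure gauss_vec {\<omega>. \<forall>j :: 'n::finite. \<omega> j \<in> B j} = (\<Prod>j\<in>UNIV. emeasure gauss_seq (B j))"
proof -
  interpret product_sigma_finite "\<lambda>_::'n. gauss_seq :: ('i \<Rightarrow> real) measure"
    by (simp add: product_sigma_finite_def prob_space_imp_sigma_finite prob_space_gauss_seq)
  have "{\<omega>. \<forall>j :: 'n. \<omega> j \<in> B j} = PiE UNIV B" by auto
  then show ?thesis unfolding gauss_vec_def using assms by (simp add: emeasure_PiM)
qed

lemma emeasure_gauss_vec_single:
  assumes "B \<in> sets (gauss_seq :: ('i::countable \<Rightarrow> real) measure)"
  shows "emeasure gauss_vec {\<omega>. \<omega> (j::'n::finite) \<in> B} = emeasure gauss_seq B"
proof -
  interpret product_prob_space "\<lambda>_::'n. gauss_seq :: ('i \<Rightarrow> real) measure" UNIV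
    by (simp add: product_prob_space_def product_prob_space_axioms_def product_sigma_finite_def
        prob_space_imp_sigma_finite prob_space_gauss_seq)
  show ?thesis
    using emeasure_PiM_Collect_single[of j B] assms by (simp add: gauss_vec_def space_PiM)
qed

section \<open>Borel sets of expanding maps and a Borel--Cantelli criterion for prevalence\<close>

definition eventually_expanding ::
    "(nat \<Rightarrow> 'a set) \<Rightarrow> (nat \<Rightarrow> real) \<Rightarrow> ('a::real_normed_vector \<Rightarrow>\<^sub>L 'b::real_normed_vector) set" where
  "eventually_expanding E t =
    (\<Union>k0. \<Inter>k\<in>{k0..}. {L. \<forall>z\<in>E k. t k * norm z \<le> norm (blinfun_apply L z)})"

lemma closed_expanding:
  "closed {L :: 'a::real_normed_vector \<Rightarrow>\<^sub>L 'b::real_normed_vector. \<forall>z\<in>E. t * norm z \<le> norm (blinfun_apply L z)}"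
proof -
  have "{L :: 'a \<Rightarrow>\<^sub>L 'b. \<forall>z\<in>E. t * norm z \<le> norm (blinfun_apply L z)}
      = (\<Inter>z\<in>E. {L. t * norm z \<le> norm (blinfun_apply L z)})" by auto
  also have "closed \<dots>"
    by (intro closed_INT ballI closed_Collect_le continuous_intros)
  finally show ?thesis .
qed

text \<open>A countable union of closed sets of maps. It serves as the Borel subset that prevalence
  asks for.\<close>

lemma borel_eventually_expanding: "eventually_expanding E t \<in> sets borel"
proof -
  have "(\<Inter>k\<in>{k0..}. {L :: 'a \<Rightarrow>\<^sub>L 'b. \<forall>z\<in>E k. t k * norm z \<le> norm (blinfun_apply L z)}) \<in> sets borel" for k0
    by (intro borel_closed closed_INT ballI closed_expanding)
  then show ?thesis unfolding eventually_expanding_def by (intro sets.countable_UN) auto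
qed

context random_functional
begin

definition Fvec :: "('n::finite \<Rightarrow> nat \<times> nat \<Rightarrow> real) \<Rightarrow> 'a \<Rightarrow>\<^sub>L (real ^ 'n)" where
  "Fvec \<omega> = (\<Sum>j\<in>UNIV. blinfun_scaleR_left (axis j 1) o\<^sub>L F (\<omega> j))"

lemma Fvec_nth: "blinfun_apply (Fvec \<omega>) x $ j = blinfun_apply (F (\<omega> j)) x"
  by (simp add: Fvec_def blinfun.sum_left axis_def if_distrib cong: if_cong)

lemma continuous_Fvec: "continuous_on UNIV Fvec"
proof -
  have "continuous_on UNIV (\<lambda>\<omega>. F (\<omega> j))" for j :: 'n
    using continuous_on_compose[OF continuous_on_product_coordinates continuous_on_subset[OF continuous_F]]
    by (simp add: o_def)
  then show ?thesis unfolding Fvec_def by (intro continuous_intros)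
qed

text \<open>The range lies in the image of a product of compact hulls under the continuous map that
  assembles coordinates.\<close>

lemma Fvec_compact: "\<exists>K. compact K \<and> range (Fvec :: ('n::finite \<Rightarrow> _) \<Rightarrow> _) \<subseteq> K"
proof -
  define G :: "_ \<Rightarrow> 'a \<Rightarrow>\<^sub>L (real ^ 'n)"
    where "G f = (\<Sum>j\<in>UNIV. blinfun_scaleR_left (axis j 1) o\<^sub>L f j)" for f :: "'n \<Rightarrow> 'a \<Rightarrow>\<^sub>L real"
  have "continuous_on (PiE UNIV (\<lambda>_. F_hull)) G"
    unfolding G_def by (intro continuous_intros continuous_on_subset[OF continuous_on_product_coordinates]) auto
  then have "compact (G ` PiE UNIV (\<lambda>_. F_hull))"
    by (rule compact_continuous_image) (rule compact_PiE_UNIV[OF compact_F_hull])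
  moreover have "range (Fvec :: ('n \<Rightarrow> _) \<Rightarrow> _) \<subseteq> G ` PiE UNIV (\<lambda>_. F_hull)"
    using F_in_hull by (auto simp: Fvec_def G_def intro!: image_eqI[where x = "\<lambda>j. F (_ j)"])
  ultimately show ?thesis by blast
qed

lemma measurable_Fvec [measurable]: "Fvec \<in> borel_measurable gauss_vec"
  by (subst measurable_cong_sets[OF sets_gauss_vec refl])
    (rule borel_measurable_continuous_onI[OF continuous_Fvec])

lemma measurable_translate [measurable]:
  "(\<lambda>L :: 'b::real_normed_vector. L + v) \<in> borel_measurable borel"
  by (intro borel_measurable_continuous_onI continuous_intros)

text \<open>The law of \<open>Fvec\<close> is the witnessing measure. A translate
  \<open>v + S'\<close> has measure 1 if almost every \<open>Fvec \<omega> - v\<close> lies in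
  \<open>S'\<close>, and the sign is immaterial since \<open>v\<close> ranges over all maps.\<close>

lemma prevalentI:
  fixes S S' :: "('a \<Rightarrow>\<^sub>L (real ^ 'n::finite)) set"
  assumes S': "S' \<in> sets borel" "S' \<subseteq> S"
    and ae: "\<And>v. AE \<omega> in gauss_vec. Fvec \<omega> + v \<in> S'"
  shows "prevalent S"
proof -
  define \<mu> where "\<mu> = distr gauss_vec borel (Fvec :: ('n \<Rightarrow> _) \<Rightarrow> _)"
  interpret g: prob_space "gauss_vec :: ('n \<Rightarrow> nat \<times> nat \<Rightarrow> real) measure" by (rule prob_space_gauss_vec)
  interpret \<mu>: prob_space \<mu> unfolding \<mu>_def by (rule g.prob_space_distr) measurable
  obtain K where K: "compact K" "range (Fvec :: ('n \<Rightarrow> _) \<Rightarrow> _) \<subseteq> K" using Fvec_compact by blast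
  have Kb: "- K \<in> sets borel" using K by (intro borel_comp borel_closed compact_imp_closed)
  have "emeasure \<mu> (- K) = emeasure gauss_vec (Fvec -` (- K) \<inter> space gauss_vec)"
    unfolding \<mu>_def by (rule emeasure_distr[OF measurable_Fvec Kb])
  also have "Fvec -` (- K) = {}" using K by auto
  finally have K0: "emeasure \<mu> (- K) = 0" by simp
  have "emeasure \<mu> ((+) v ` S') = 1" for v
  proof -
    have eq: "(+) v ` S' = (\<lambda>L. L + (- v)) -` S' \<inter> space borel"
      by (auto simp: image_iff) (metis add.commute diff_add_cancel)
    have m: "(+) v ` S' \<in> sets borel"
      unfolding eq by (rule measurable_sets[OF measurable_translate S'(1)])
    then have "emeasure \<mu> ((+) v ` S') = emeasure gauss_vec (Fvec -` ((+) v ` S') \<inter> space gauss_vec)"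
      unfolding \<mu>_def by (rule emeasure_distr[OF measurable_Fvec])
    also have "\<dots> = 1"
    proof (rule g.emeasure_eq_1_AE)
      show "Fvec -` ((+) v ` S') \<inter> space gauss_vec \<in> sets gauss_vec"
        by (rule measurable_sets[OF measurable_Fvec m])
      show "AE \<omega> in gauss_vec. \<omega> \<in> Fvec -` ((+) v ` S') \<inter> space gauss_vec"
        using ae[of "- v"] by eventually_elim (simp add: eq)
    qed
    finally show ?thesis .
  qed
  with S' K K0 \<mu>.prob_space_axioms show ?thesis
    unfolding prevalent_def by (intro exI[of _ \<mu>] exI[of _ K] exI[of _ S']) (simp add: \<mu>_def)
qed

text \<open>Borel--Cantelli is applied for each natural bound \<open>R\<close> on the norm, because
  the failure estimate depends on \<open>R\<close>. Every map has finite norm, so countably many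
  values of \<open>R\<close> cover all outcomes.\<close>

lemma prevalent_eventually_expanding:
  fixes S :: "('a \<Rightarrow>\<^sub>L (real ^ 'n::finite)) set"
  assumes sub: "eventually_expanding E t \<subseteq> S"
    and p: "\<And>(v :: 'a \<Rightarrow>\<^sub>L (real ^ 'n)) (R :: nat). \<exists>p. summable p \<and> (\<forall>k. 0 \<le> p k \<and> emeasure gauss_vec {\<omega>. norm (Fvec \<omega> + v) \<le> real R \<and>
      (\<exists>z\<in>E k. norm (blinfun_apply (Fvec \<omega> + v) z) < t k * norm z)} \<le> ennreal (p k))"
  shows "prevalent S"
proof (rule prevalentI[OF borel_eventually_expanding sub])
  fix v :: "'a \<Rightarrow>\<^sub>L (real ^ 'n)"
  define B where "B R k = {\<omega>. norm (Fvec \<omega> + v) \<le> real R \<and>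
      (\<exists>z\<in>E k. norm (blinfun_apply (Fvec \<omega> + v) z) < t k * norm z)}" for R k
  have Bm: "B R k \<in> sets gauss_vec" for R k
  proof -
    let ?C = "cball 0 (real R) \<inter>
        - {L :: 'a \<Rightarrow>\<^sub>L (real ^ 'n). \<forall>z\<in>E k. t k * norm z \<le> norm (blinfun_apply L z)}"
    have eq: "B R k = (\<lambda>\<omega>. Fvec \<omega> + v) -` ?C \<inter> space gauss_vec"
      by (auto simp: B_def not_le)
    have C: "?C \<in> sets borel"
      by (intro sets.Int borel_closed borel_comp closed_cball closed_expanding)
    show ?thesis unfolding eq
      by (rule measurable_sets[OF measurable_compose[OF measurable_Fvec measurable_translate] C])
  qed
  have "AE \<omega> in gauss_vec. \<forall>\<^sub>F k in sequentially. \<omega> \<in> space gauss_vec - B R k" for R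
  proof (rule borel_cantelli_AE1[OF Bm])
    interpret g: prob_space "gauss_vec :: ('n \<Rightarrow> nat \<times> nat \<Rightarrow> real) measure" by (rule prob_space_gauss_vec)
    obtain p where p: "summable p" "\<And>k. 0 \<le> p k" "\<And>k. emeasure gauss_vec (B R k) \<le> ennreal (p k)"
      unfolding B_def using p[of v R] by blast
    show "emeasure gauss_vec (B R k) < \<infinity>" for k by (simp add: g.emeasure_eq_measure)
    show "summable (\<lambda>k. measure gauss_vec (B R k))"
    proof (rule summable_comparison_test'[OF p(1), of 0])
      show "norm (measure gauss_vec (B R k)) \<le> p k" for k
        using p(2,3)[of k] by (simp add: g.emeasure_eq_measure)
    qed
  qed
  then have "AE \<omega> in gauss_vec. \<forall>R. \<forall>\<^sub>F k in sequentially. \<omega> \<in> space gauss_vec - B R k"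
    by (simp add: AE_all_countable)
  then show "AE \<omega> in gauss_vec. Fvec \<omega> + v \<in> eventually_expanding E t"
  proof eventually_elim
    case (elim \<omega>)
    obtain R :: nat where R: "norm (Fvec \<omega> + v) \<le> real R" using real_arch_simple by blast
    from elim obtain k0 where "\<And>k. k \<ge> k0 \<Longrightarrow> \<omega> \<notin> B R k"
      by (auto simp: eventually_sequentially)
    with R show ?case by (fastforce simp: eventually_expanding_def B_def not_less)
  qed
qed

text \<open>
  Replacing \<open>z\<close> by a nearby centre \<open>c\<close> costs only a factor \<open>1 + R\<close> in the threshold, because
  the perturbed map is assumed to have norm at most \<open>R\<close>.
\<close>

lemma expansion_failure_bound:
  fixes v :: "'a \<Rightarrow>\<^sub>L (real ^ 'n::finite)"
  assumes C: "finite C" "\<And>c. c \<in> C \<Longrightarrow> c \<noteq> 0"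
      "\<And>c. c \<in> C \<Longrightarrow> s * norm c \<le> 2 * sqrt (\<Sum>i<D k. (blinfun_apply (\<psi> k i) c)\<^sup>2)"
    and cover: "\<And>z. z \<in> E \<Longrightarrow> \<exists>c\<in>C. norm (z - c) \<le> t * norm z \<and> norm z \<le> 2 * norm c"
    and t: "t > 0" and s: "s > 0" and R: "R \<ge> 0"
  shows "emeasure gauss_vec {\<omega>. norm (Fvec \<omega> + v) \<le> R \<and>
      (\<exists>z\<in>E. norm (blinfun_apply (Fvec \<omega> + v) z) < t * norm z)}
    \<le> ennreal (CARD('n) * (D k / (r k)\<^sup>2) + card C * (4 * (1 + R) * t / s) ^ CARD('n))"
proof -
  \<comment> \<open>Failure at \<open>z\<close> gives less than \<open>t * norm z\<close>, passing
    from \<open>z\<close> to \<open>c\<close> adds at most \<open>R * (t * norm z)\<close>, and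
    \<open>norm z \<le> 2 * norm c\<close>. The other factor 2 in the final constant 4 comes from
    the norming hypothesis on \<open>C\<close>.\<close>
  define \<epsilon> where "\<epsilon> c = (1 + R) * t * (2 * norm c)" for c :: 'a
  define G where "G w c = {\<xi>. energy k \<xi> \<le> r k \<and> \<bar>w + blinfun_apply (F \<xi>) c\<bar> < \<epsilon> c}" for w c
  define T where "T = {\<xi>. energy k \<xi> > r k}"
  have Tm: "T \<in> sets gauss_seq"
    unfolding T_def sets_gauss_seq
    by (intro borel_open open_Collect_less continuous_energy continuous_on_const)
  have Gm: "G w c \<in> sets gauss_seq" for w c
  proof -
    have "open {\<xi>. \<bar>w + blinfun_apply (F \<xi>) c\<bar> < \<epsilon> c}"
      by (intro open_Collect_less continuous_intros continuous_F)
    moreover have "closed {\<xi>. energy k \<xi> \<le> r k}"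
      by (intro closed_Collect_le continuous_energy continuous_on_const)
    moreover have "G w c = {\<xi>. energy k \<xi> \<le> r k} \<inter> {\<xi>. \<bar>w + blinfun_apply (F \<xi>) c\<bar> < \<epsilon> c}"
      by (auto simp: G_def)
    ultimately show ?thesis unfolding sets_gauss_seq by (metis borel_closed borel_open sets.Int)
  qed
  let ?G = "\<lambda>c. {\<omega>. \<forall>j. \<omega> j \<in> G (blinfun_apply v c $ j) c}"
  let ?T = "\<lambda>j. {\<omega>. \<omega> j \<in> T}"
  have Tm': "?T j \<in> sets gauss_vec" for j :: 'n
  proof -
    have "(\<lambda>\<omega>. \<omega> j) \<in> measurable gauss_vec gauss_seq" unfolding gauss_vec_def by simp
    from measurable_sets[OF this Tm] show ?thesis by (simp add: vimage_def)
  qed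
  have Gm': "?G c \<in> sets gauss_vec" for c
  proof -
    have "(\<lambda>\<omega>. \<omega> j) \<in> measurable gauss_vec gauss_seq" for j :: 'n unfolding gauss_vec_def by simp
    from measurable_sets[OF this Gm]
    have "(\<Inter>j\<in>UNIV. {\<omega> :: 'n \<Rightarrow> nat \<times> nat \<Rightarrow> real. \<omega> j \<in> G (blinfun_apply v c $ j) c}) \<in> sets gauss_vec"
      by (intro sets.finite_INT) (auto simp: vimage_def)
    also have "(\<Inter>j\<in>UNIV. {\<omega>. \<omega> j \<in> G (blinfun_apply v c $ j) c}) = ?G c" by auto
    finally show ?thesis .
  qed
  \<comment> \<open>Either the block exceeds its radius in some coordinate, or all coordinates of
    the map are small at one of the centres.\<close>
  have sub: "{\<omega>. norm (Fvec \<omega> + v) \<le> R \<and>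
      (\<exists>z\<in>E. norm (blinfun_apply (Fvec \<omega> + v) z) < t * norm z)} \<subseteq> (\<Union>j\<in>(UNIV :: 'n set). ?T j) \<union> (\<Union>c\<in>C. ?G c)"
  proof safe
    fix \<omega> :: "'n \<Rightarrow> nat \<times> nat \<Rightarrow> real" and z
    assume n: "norm (Fvec \<omega> + v) \<le> R" and z: "z \<in> E"
      and lt: "norm (blinfun_apply (Fvec \<omega> + v) z) < t * norm z"
      and nG: "\<omega> \<notin> (\<Union>c\<in>C. ?G c)"
    from cover[OF z] obtain c where c: "c \<in> C" "norm (z - c) \<le> t * norm z" "norm z \<le> 2 * norm c" by blast
    have "norm (blinfun_apply (Fvec \<omega> + v) c)
        \<le> norm (blinfun_apply (Fvec \<omega> + v) z) + norm (blinfun_apply (Fvec \<omega> + v) (z - c))"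
      unfolding blinfun.diff_right by (metis norm_minus_commute norm_triangle_sub)
    also have "norm (blinfun_apply (Fvec \<omega> + v) (z - c)) \<le> R * (t * norm z)"
      by (rule order_trans[OF norm_blinfun mult_mono]) (use n c R in auto)
    finally have "norm (blinfun_apply (Fvec \<omega> + v) c) < (1 + R) * t * norm z"
      using lt by (simp add: algebra_simps)
    also have "\<dots> \<le> \<epsilon> c" unfolding \<epsilon>_def using c t R by (intro mult_left_mono) auto
    finally have less: "norm (blinfun_apply (Fvec \<omega> + v) c) < \<epsilon> c" .
    have "\<bar>blinfun_apply v c $ j + blinfun_apply (F (\<omega> j)) c\<bar> < \<epsilon> c" for j
      using component_le_norm_cart[of "blinfun_apply (Fvec \<omega> + v) c" j] less
      by (simp add: blinfun.add_left Fvec_nth add.commute)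
    with nG c(1) obtain j where "\<not> energy k (\<omega> j) \<le> r k" by (auto simp: G_def)
    then show "\<omega> \<in> (\<Union>j\<in>(UNIV :: 'n set). ?T j)" by (auto simp: T_def not_le)
  qed
  have Gb: "emeasure gauss_vec (?G c) \<le> ennreal ((4 * (1 + R) * t / s) ^ CARD('n))" if c: "c \<in> C" for c
  proof -
    let ?\<sigma> = "sqrt (\<Sum>i<D k. (blinfun_apply (\<psi> k i) c)\<^sup>2)"
    have pos: "s * norm c > 0" using s C(2)[OF c] by simp
    with C(3)[OF c] have \<sigma>: "?\<sigma> > 0" by linarith
    have e: "\<epsilon> c \<ge> 0" using t R by (simp add: \<epsilon>_def)
    have "\<epsilon> c / ?\<sigma> \<le> \<epsilon> c / (s * norm c / 2)"
      using C(3)[OF c] pos e \<sigma> by (intro divide_left_mono mult_pos_pos) linarith+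
    also have "\<dots> = 4 * (1 + R) * t / s" using C(2)[OF c] s by (simp add: \<epsilon>_def field_simps)
    finally have le: "\<epsilon> c / ?\<sigma> \<le> 4 * (1 + R) * t / s" .
    have "emeasure gauss_vec (?G c) = (\<Prod>j\<in>UNIV. emeasure gauss_seq (G (blinfun_apply v c $ j) c))"
      by (rule emeasure_gauss_vec_all[OF Gm])
    also have "\<dots> \<le> (\<Prod>j\<in>(UNIV::'n set). ennreal (4 * (1 + R) * t / s))"
    proof -
      have G1: "emeasure gauss_seq (G w c) \<le> ennreal (4 * (1 + R) * t / s)" for w
        unfolding G_def by (rule order_trans[OF small_ball[OF \<sigma> e] ennreal_leI[OF le]])
      show ?thesis by (rule prod_mono_ennreal) (rule G1)
    qed
    also have "\<dots> = ennreal ((4 * (1 + R) * t / s) ^ CARD('n))"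
      using t s R by (simp add: ennreal_power)
    finally show ?thesis .
  qed
  have Tb: "emeasure gauss_vec (?T j) \<le> ennreal (D k / (r k)\<^sup>2)" for j :: 'n
    using energy_tail[of k] emeasure_gauss_vec_single[OF Tm, of j] by (simp add: T_def)
  let ?q = "(4 * (1 + R) * t / s) ^ CARD('n)"
  have q: "?q \<ge> 0" using t s R by simp
  have "emeasure gauss_vec {\<omega>. norm (Fvec \<omega> + v) \<le> R \<and>
      (\<exists>z\<in>E. norm (blinfun_apply (Fvec \<omega> + v) z) < t * norm z)}
    \<le> emeasure gauss_vec ((\<Union>j\<in>(UNIV :: 'n set). ?T j) \<union> (\<Union>c\<in>C. ?G c))"
    using Tm' Gm' C(1) by (intro emeasure_mono[OF sub] sets.Un sets.finite_UN) auto
  also have "\<dots> \<le> emeasure gauss_vec (\<Union>j\<in>(UNIV :: 'n set). ?T j) + emeasure gauss_vec (\<Union>c\<in>C. ?G c)"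
    by (rule emeasure_subadditive; rule sets.finite_UN) (use Tm' Gm' C(1) in auto)
  also have "\<dots> \<le> (\<Sum>j\<in>(UNIV :: 'n set). emeasure gauss_vec (?T j)) + (\<Sum>c\<in>C. emeasure gauss_vec (?G c))"
    using Tm' Gm' C(1) by (intro add_mono emeasure_subadditive_finite) auto
  also have "\<dots> \<le> (\<Sum>j\<in>(UNIV::'n set). ennreal (D k / (r k)\<^sup>2)) + (\<Sum>c\<in>C. ennreal ?q)"
    by (intro add_mono sum_mono Tb Gb)
  also have "\<dots> = ennreal ((\<Sum>j\<in>(UNIV::'n set). D k / (r k)\<^sup>2) + (\<Sum>c\<in>C. ?q))"
    using q by (subst ennreal_plus) (simp_all add: sum_nonneg del: sum_constant)
  finally show ?thesis by simp
qed

end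

section \<open>Homogeneous sets at dyadic scales\<close>

lemma dyadic_scale:
  fixes x :: real
  assumes "0 < x" "x \<le> 1"
  obtains n :: nat where "(1 / 2) ^ Suc n < x" "x \<le> (1 / 2) ^ n"
proof -
  obtain n where "(1 / 2) ^ n < x" using real_arch_pow_inv[of x "1 / 2"] assms by auto
  then have ex: "\<exists>n. (1 / 2) ^ Suc n < x"
    by (intro exI[of _ n]) (use assms in auto)
  define n where "n = (LEAST n. (1 / 2) ^ Suc n < x)"
  have "(1 / 2) ^ Suc n < x" unfolding n_def by (rule LeastI_ex[OF ex])
  moreover have "x \<le> (1 / 2) ^ n"
  proof (cases n)
    case (Suc k)
    then show ?thesis using not_less_Least[of k "\<lambda>n. (1 / 2) ^ Suc n < x"] by (simp add: n_def)
  qed (use assms in simp)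
  ultimately show ?thesis by (rule that)
qed

text \<open>On block \<open>k\<close> the size of \<open>ln (norm z)\<close> agrees with
  \<open>2 ^ k\<close> up to a constant factor, so a single threshold
  \<open>2 powr (- \<gamma> * real k)\<close> stands for the logarithmic factor there.\<close>

definition dyadic_block :: "'a::real_normed_vector set \<Rightarrow> nat \<Rightarrow> 'a set" where
  "dyadic_block Z k =
    {z\<in>Z. \<exists>n. 2 ^ k \<le> n \<and> n < 2 ^ Suc k \<and> (1 / 2) ^ Suc n \<le> norm z \<and> norm z \<le> (1 / 2) ^ n}"

lemma homogeneous_cover:
  assumes "homogeneous_set M s Z" "0 < \<rho>" "\<rho> < r" "0 \<in> Z"
  obtains C where "finite C" "real (card C) \<le> M * (r / \<rho>) powr s"
    "\<And>z. z \<in> Z \<Longrightarrow> norm z < r \<Longrightarrow> \<exists>c\<in>C. norm (z - c) < \<rho>"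
proof -
  obtain C where C: "finite C" "real (card C) \<le> M * (r / \<rho>) powr s" "ball 0 r \<inter> Z \<subseteq> (\<Union>c\<in>C. ball c \<rho>)"
    using assms unfolding homogeneous_set_def by meson
  have "\<exists>c\<in>C. norm (z - c) < \<rho>" if "z \<in> Z" "norm z < r" for z
    using C(3) that by (fastforce simp: dist_norm norm_minus_commute)
  with C show ?thesis using that by blast
qed

text \<open>At every scale the covering radii have the same ratio, so \<open>m\<close> centres per
  scale suffice. The annuli are wider than those of \<open>dyadic_block\<close> because the estimate
  is later applied to centres of covering balls, which may lie slightly outside the block.\<close>

lemma homogeneous_norming_blocks:
  fixes Z :: "'a::banach set"
  assumes hom: "homogeneous_set M s Z" "M \<ge> 1" "0 \<in> Z"
    and \<alpha>: "\<alpha> = (if is_hilbert TYPE('a) then 1 / 2 else 1)"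
  obtains m :: nat and \<psi> :: "nat \<Rightarrow> nat \<Rightarrow> 'a \<Rightarrow>\<^sub>L real" where "m > 0"
    "\<And>k x. norm (\<Sum>i<m * 2 ^ k. x i *\<^sub>R \<psi> k i)
      \<le> real (m * 2 ^ k) powr (\<alpha> - 1 / 2) * sqrt (\<Sum>i<m * 2 ^ k. (x i)\<^sup>2)"
    "\<And>k n z. z \<in> Z \<Longrightarrow> 2 ^ k \<le> n \<Longrightarrow> n < 2 ^ Suc k \<Longrightarrow> (1 / 2) ^ n / 4 \<le> norm z \<Longrightarrow>
      norm z < 4 * (1 / 2) ^ n \<Longrightarrow> norm z \<le> 2 * sqrt (\<Sum>i<m * 2 ^ k. (blinfun_apply (\<psi> k i) z)\<^sup>2)"
proof -
  \<comment> \<open>The radii \<open>4 * (1 / 2) ^ n\<close> and \<open>(1 / 2) ^ n / 16\<close>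
    have ratio 64. The smaller one makes twice the distance to a centre at most
    \<open>norm z / 2\<close>, which the left side of the norming inequality absorbs.\<close>
  define m where "m = nat \<lceil>M * 64 powr s\<rceil>"
  have "M * 64 powr s > 0" using hom(2) by simp
  then have m: "m > 0" "M * 64 powr s \<le> real m" unfolding m_def by linarith+
  have "\<exists>f :: nat \<Rightarrow> 'a. \<forall>z\<in>Z. norm z < 4 * (1 / 2) ^ n \<longrightarrow> (\<exists>i<m. norm (z - f i) < (1 / 2) ^ n / 16)" for n
  proof -
    have "(1 / 2) ^ n / 16 < (4 * (1 / 2) ^ n :: real)" "0 < ((1 / 2) ^ n / 16 :: real)" by simp_all
    then obtain C where C: "finite C" "real (card C) \<le> M * (4 * (1 / 2) ^ n / ((1 / 2) ^ n / 16)) powr s"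
      "\<And>z. z \<in> Z \<Longrightarrow> norm z < 4 * (1 / 2) ^ n \<Longrightarrow> \<exists>c\<in>C. norm (z - c) < (1 / 2) ^ n / 16"
      using homogeneous_cover[OF hom(1) _ _ hom(3), of "(1 / 2) ^ n / 16" "4 * (1 / 2) ^ n"] by blast
    obtain f where f: "bij_betw f {0..<card C} C" using ex_bij_betw_nat_finite[OF C(1)] by blast
    have "card C \<le> m" using C(2) m(2) by simp
    have "\<exists>i<m. norm (z - f i) < (1 / 2) ^ n / 16" if z: "z \<in> Z" "norm z < 4 * (1 / 2) ^ n" for z
    proof -
      obtain c where c: "c \<in> C" "norm (z - c) < (1 / 2) ^ n / 16" using C(3)[OF z] by blast
      with f obtain i where "i < card C" "c = f i" unfolding bij_betw_def by (metis atLeastLessThan_iff imageE)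
      with c \<open>card C \<le> m\<close> show ?thesis by (intro exI[of _ i]) simp
    qed
    then show ?thesis by blast
  qed
  then obtain f :: "nat \<Rightarrow> nat \<Rightarrow> 'a" where
    f: "\<And>n z. z \<in> Z \<Longrightarrow> norm z < 4 * (1 / 2) ^ n \<Longrightarrow> \<exists>i<m. norm (z - f n i) < (1 / 2) ^ n / 16"
    by metis
  \<comment> \<open>The \<open>m\<close> centres of each of the \<open>2 ^ k\<close> scales in one
    list: the quotient selects the scale and the remainder the centre.\<close>
  define c where "c k l = f (2 ^ k + l div m) (l mod m)" for k l :: nat
  define Q where "Q k \<psi> \<longleftrightarrow>
    (\<forall>x. norm (\<Sum>i<m * 2 ^ k. x i *\<^sub>R \<psi> i)
      \<le> real (m * 2 ^ k) powr (\<alpha> - 1 / 2) * sqrt (\<Sum>i<m * 2 ^ k. (x i)\<^sup>2)) \<and>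
    (\<forall>l<m * 2 ^ k. \<forall>z. norm z \<le> 2 * norm (z - c k l) + sqrt (\<Sum>i<m * 2 ^ k. (blinfun_apply (\<psi> i) z)\<^sup>2))"
    for k and \<psi> :: "nat \<Rightarrow> 'a \<Rightarrow>\<^sub>L real"
  have "\<exists>\<psi>. Q k \<psi>" for k
    unfolding Q_def by (rule norming_family[OF \<alpha>, of "m * 2 ^ k" "c k"]) (use m in auto)
  then obtain \<psi> where Q: "\<And>k. Q k (\<psi> k)" by metis
  note \<psi> = Q[unfolded Q_def, THEN conjunct1, rule_format] Q[unfolded Q_def, THEN conjunct2, rule_format]
  show ?thesis
  proof (rule that[OF m(1) \<psi>(1)])
    fix k n :: nat and z
    assume z: "z \<in> Z" and n: "2 ^ k \<le> n" "n < 2 ^ Suc k"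
      and nz: "(1 / 2) ^ n / 4 \<le> norm z" "norm z < 4 * (1 / 2) ^ n"
    from f[OF z nz(2)] obtain i where i: "i < m" "norm (z - f n i) < (1 / 2) ^ n / 16" by blast
    define l where "l = (n - 2 ^ k) * m + i"
    have "c k l = f n i" using i(1) n(1) by (simp add: c_def l_def)
    moreover have "l < m * 2 ^ k"
    proof -
      have "l < (n - 2 ^ k + 1) * m" using i(1) by (simp add: l_def)
      also have "\<dots> \<le> 2 ^ k * m" using n by (intro mult_right_mono) auto
      finally show ?thesis by (simp add: mult.commute)
    qed
    ultimately show "norm z \<le> 2 * sqrt (\<Sum>i<m * 2 ^ k. (blinfun_apply (\<psi> k i) z)\<^sup>2)"
      using \<psi>(2)[of l k z] i(2) nz(1) by simp
  qed
qed

text \<open>One fine cover for each of the \<open>2 ^ k\<close> scales, with ratio of radii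
  \<open>8 / t\<close> throughout. The centres stay in \<open>Z\<close>, so that the norming
  functionals of block \<open>k\<close> control them.\<close>

lemma dyadic_block_cover:
  fixes Z :: "'a::real_normed_vector set"
  assumes hom: "homogeneous_set M s Z" "0 \<in> Z" and t: "0 < t" "t \<le> 1"
  obtains C where "finite C" "real (card C) \<le> 2 ^ k * (M * (8 / t) powr s)"
    "\<And>c. c \<in> C \<Longrightarrow> \<exists>n. 2 ^ k \<le> n \<and> n < 2 ^ Suc k \<and> (1 / 2) ^ n / 4 \<le> norm c \<and> norm c < 4 * (1 / 2) ^ n"
    "C \<subseteq> Z"
    "\<And>z. z \<in> dyadic_block Z k \<Longrightarrow> \<exists>c\<in>C. norm (z - c) \<le> t * norm z \<and> norm z \<le> 2 * norm c"
proof -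
  have "\<exists>C. finite C \<and> C \<subseteq> Z \<and> real (card C) \<le> M * (8 / t) powr s \<and>
      (\<forall>z\<in>Z. norm z < 2 * (1 / 2) ^ n \<longrightarrow> (\<exists>c\<in>C. norm (z - c) < t * (1 / 2) ^ n / 4))" for n
  proof -
    let ?h = "(1 / 2) ^ n :: real"
    have h: "?h > 0" by simp
    have "t * ?h / 4 < 2 * ?h" using t h by (simp add: field_simps)
    moreover have "t * ?h / 4 > 0" using t by simp
    ultimately obtain C where "finite C" "C \<subseteq> Z" "real (card C) \<le> M * (2 * ?h / (t * ?h / 4)) powr s"
      "ball 0 (2 * ?h) \<inter> Z \<subseteq> (\<Union>c\<in>C. ball c (t * ?h / 4))"
      using hom unfolding homogeneous_set_def by meson
    moreover have "2 * ?h / (t * ?h / 4) = 8 / t" using t by simp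
    ultimately show ?thesis
      by (intro exI[of _ C]) (fastforce simp: dist_norm norm_minus_commute)
  qed
  then obtain C where C: "\<And>n. finite (C n)" "\<And>n. C n \<subseteq> Z" "\<And>n. real (card (C n)) \<le> M * (8 / t) powr s"
      "\<And>n z. z \<in> Z \<Longrightarrow> norm z < 2 * (1 / 2) ^ n \<Longrightarrow> \<exists>c\<in>C n. norm (z - c) < t * (1 / 2) ^ n / 4"
    by metis
  \<comment> \<open>Keeping only this annulus makes the centres nonzero and places them within reach
    of the norming functionals. The centre found for a point \<open>z\<close> of the block survives,
    being at distance at most \<open>norm z / 2\<close>.\<close>
  define C' where "C' n = {c\<in>C n. (1 / 2) ^ n / 4 \<le> norm c \<and> norm c < 4 * (1 / 2) ^ n}" for n
  have C': "finite (C' n)" "real (card (C' n)) \<le> M * (8 / t) powr s" for n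
  proof -
    show "finite (C' n)" using C(1) by (simp add: C'_def)
    have "card (C' n) \<le> card (C n)" using C(1) by (intro card_mono) (auto simp: C'_def)
    with C(3)[of n] show "real (card (C' n)) \<le> M * (8 / t) powr s" by linarith
  qed
  let ?I = "{2 ^ k..<2 ^ Suc k} :: nat set"
  show ?thesis
  proof (rule that[of "\<Union>n\<in>?I. C' n"])
    show "finite (\<Union>n\<in>?I. C' n)" using C' by auto
    have "real (card (\<Union>n\<in>?I. C' n)) \<le> (\<Sum>n\<in>?I. real (card (C' n)))"
      using card_UN_le[of ?I C'] by (simp flip: of_nat_sum)
    also have "\<dots> \<le> (\<Sum>n\<in>?I. M * (8 / t) powr s)" by (intro sum_mono C')
    finally show "real (card (\<Union>n\<in>?I. C' n)) \<le> 2 ^ k * (M * (8 / t) powr s)" by simp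
  next
    fix z assume "z \<in> dyadic_block Z k"
    then obtain n where z: "z \<in> Z" and n: "n \<in> ?I" "(1 / 2) ^ Suc n \<le> norm z" "norm z \<le> (1 / 2) ^ n"
      by (auto simp: dyadic_block_def)
    let ?h = "(1 / 2) ^ n :: real"
    have h: "?h > 0" by simp
    then have "norm z < 2 * ?h" using n(3) by linarith
    with C(4)[OF z] obtain c where c: "c \<in> C n" "norm (z - c) < t * ?h / 4" by blast
    \<comment> \<open>Since \<open>norm z\<close> is at least \<open>?h / 2\<close>, the absolute
      radius \<open>t * ?h / 4\<close> becomes the relative error \<open>t / 2\<close>.\<close>
    have "t * ?h \<le> t * (2 * norm z)" using n(2) t by (intro mult_left_mono) auto
    then have zc: "norm (z - c) \<le> t * norm z / 2" using c(2) by simp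
    also have "\<dots> \<le> norm z / 2" using t by (simp add: mult_left_le_one_le)
    finally have zc2: "norm (z - c) \<le> norm z / 2" .
    then have zc3: "norm z \<le> 2 * norm c" and "norm c \<le> 3 / 2 * norm z"
      using norm_triangle_sub[of z c] norm_triangle_sub[of c z] by (auto simp: norm_minus_commute)
    with n(2,3) h have "norm c < 4 * ?h" "?h / 4 \<le> norm c" unfolding power_Suc by linarith+
    then have "c \<in> C' n" using c(1) by (simp add: C'_def)
    moreover have "norm (z - c) \<le> t * norm z" using zc t by (smt (verit) mult_nonneg_nonneg norm_ge_zero field_sum_of_halves)
    ultimately show "\<exists>c\<in>\<Union>n\<in>?I. C' n. norm (z - c) \<le> t * norm z \<and> norm z \<le> 2 * norm c"
      using n(1) zc3 by blast
  next
    show "(\<Union>n\<in>?I. C' n) \<subseteq> Z" using C(2) by (auto simp: C'_def)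
  qed (auto simp: C'_def)
qed

text \<open>The upper bound is the operator norm. For the lower bound, a difference at scale
  \<open>n\<close> in block \<open>k\<close> has logarithm of size at least \<open>n * ln 2\<close>,
  hence at least \<open>2 ^ k * ln 2\<close>.\<close>

lemma eventually_expanding_imp_almost_bilipschitz:
  fixes X :: "'a::real_normed_vector set"
  assumes L: "L \<in> eventually_expanding (dyadic_block (difference_set X)) (\<lambda>k. 2 powr (- \<gamma> * real k))"
    and \<gamma>: "\<gamma> > 0"
  shows "almost_bilipschitz_on \<gamma> X (blinfun_apply L)"
proof -
  obtain k0 where k0: "\<And>k z. k \<ge> k0 \<Longrightarrow> z \<in> dyadic_block (difference_set X) k \<Longrightarrow>
      2 powr (- \<gamma> * real k) * norm z \<le> norm (blinfun_apply L z)"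
    using L by (auto simp: eventually_expanding_def)
  \<comment> \<open>The second entry compensates for the \<open>ln 2\<close> between binary and
    natural logarithms, and keeps \<open>c\<close> positive when \<open>L\<close> vanishes.\<close>
  define c where "c = max (norm L) (ln 2 powr - \<gamma>)"
  have c: "c > 0" "norm L \<le> c" "ln 2 powr - \<gamma> \<le> c" by (auto simp: c_def less_max_iff_disj)
  \<comment> \<open>Differences of norm at most \<open>\<rho>\<close> have scale
    \<open>n \<ge> 2 ^ k0\<close>, so their block has index at least \<open>k0\<close>.\<close>
  define \<rho> :: real where "\<rho> = (1 / 2) ^ (2 ^ k0)"
  have \<rho>: "0 < \<rho>" "\<rho> < 1" by (auto simp: \<rho>_def power_less_one_iff)
  have "1 / c * (norm (x - y) / \<bar>ln (norm (x - y))\<bar> powr \<gamma>) \<le> norm (blinfun_apply L x - blinfun_apply L y) \<and>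
      norm (blinfun_apply L x - blinfun_apply L y) \<le> c * norm (x - y)"
    if xy: "x \<in> X" "y \<in> X" "0 < norm (x - y)" "norm (x - y) \<le> \<rho>" for x y
  proof -
    define z where "z = x - y"
    have z: "z \<in> difference_set X" "0 < norm z" "norm z \<le> \<rho>" using xy by (auto simp: z_def difference_set_def)
    obtain n where n: "(1 / 2) ^ Suc n < norm z" "norm z \<le> (1 / 2) ^ n"
      using dyadic_scale[of "norm z"] z \<rho> by auto
    have "(1 / 2) ^ Suc n < (1 / 2 :: real) ^ (2 ^ k0)" using n(1) z(3) by (simp add: \<rho>_def)
    then have "2 ^ k0 < Suc n" by (subst (asm) power_strict_decreasing_iff) auto
    then have n0: "2 ^ k0 \<le> n" by simp
    \<comment> \<open>The scale 0 belongs to no block and has to be excluded.\<close>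
    moreover have "(1::nat) \<le> 2 ^ k0" by simp
    ultimately have n1: "1 \<le> n" by linarith
    then obtain k where k: "2 ^ k \<le> n" "n < 2 ^ Suc k" using ex_power_ivl1[of 2 n] by auto
    have "(2::nat) ^ k0 < 2 ^ Suc k" using n0 k by linarith
    then have "k0 \<le> k" by (subst (asm) power_strict_increasing_iff) auto
    moreover have "z \<in> dyadic_block (difference_set X) k"
      unfolding dyadic_block_def using z n k by (intro CollectI conjI exI[of _ n]) auto
    ultimately have low: "2 powr (- \<gamma> * real k) * norm z \<le> norm (blinfun_apply L z)" by (rule k0)
    have "ln (norm z) \<le> ln ((1 / 2) ^ n)" using n z by simp
    also have "\<dots> = - (real n * ln 2)" by (simp add: ln_realpow ln_div)
    finally have ln: "real n * ln 2 \<le> \<bar>ln (norm z)\<bar>" by linarith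
    have "2 powr real k = real (2 ^ k)" by (simp add: powr_realpow)
    also have "\<dots> \<le> real n" using k by (simp only: of_nat_le_iff)
    finally have nk: "2 powr real k \<le> real n" .
    have "\<bar>ln (norm z)\<bar> powr - \<gamma> \<le> (2 powr real k * ln 2) powr - \<gamma>"
      using ln nk \<gamma> by (intro powr_mono2') (auto intro: order_trans[OF mult_right_mono])
    also have "\<dots> = 2 powr (- \<gamma> * real k) * ln 2 powr - \<gamma>"
      by (simp add: powr_mult powr_powr mult.commute)
    also have "\<dots> \<le> 2 powr (- \<gamma> * real k) * c" by (intro mult_left_mono c) auto
    finally have "norm z * \<bar>ln (norm z)\<bar> powr - \<gamma> \<le> norm z * (2 powr (- \<gamma> * real k) * c)"
      by (intro mult_left_mono) auto
    also have "\<dots> = c * (2 powr (- \<gamma> * real k) * norm z)" by simp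
    also have "\<dots> \<le> c * norm (blinfun_apply L z)" using low c by (intro mult_left_mono) auto
    finally have "norm z * \<bar>ln (norm z)\<bar> powr - \<gamma> / c \<le> norm (blinfun_apply L z)"
      using c(1) by (simp add: pos_divide_le_eq mult.commute)
    then have "1 / c * (norm z / \<bar>ln (norm z)\<bar> powr \<gamma>) \<le> norm (blinfun_apply L z)"
      by (simp add: powr_minus_divide mult.commute)
    moreover have "norm (blinfun_apply L z) \<le> c * norm z"
      using norm_blinfun[of L z] c(2) by (meson mult_right_mono norm_ge_zero order_trans)
    ultimately show ?thesis by (simp add: z_def blinfun.diff_right)
  qed
  with c \<rho> show ?thesis unfolding almost_bilipschitz_on_def by blast
qed

section \<open>Choice of the weights and summation over the blocks\<close>

lemma prevalent_UNIV: "prevalent (UNIV :: 'v::real_normed_vector set)"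
  unfolding prevalent_def
proof (intro exI conjI allI)
  show "prob_space (return borel (0::'v))" by (rule prob_space_return) simp
  show "compact {0::'v}" by simp
  show "emeasure (return borel (0::'v)) (- {0}) = 0"
    by (subst emeasure_return) (auto intro: borel_comp)
  show "emeasure (return borel (0::'v)) ((+) v ` UNIV) = 1" for v
    by (subst emeasure_return) (auto simp: surj_plus)
qed auto

theorem theorem3p1:
  fixes X :: "'a::banach set" and d \<alpha> \<gamma> :: real
  assumes "compact X"
    and "assouad_dim (difference_set X) < ereal d"
    and "d < real CARD('n::finite)"
    and "\<alpha> = (if is_hilbert TYPE('a) then 1 / 2 else 1)"
    and "\<gamma> > (\<alpha> * real CARD('n) + 1) / (real CARD('n) - d)"
  shows "prevalent {L :: 'a \<Rightarrow>\<^sub>L (real ^ 'n). almost_bilipschitz_on \<gamma> X (blinfun_apply L)}"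
proof (cases "X = {}")
  \<comment> \<open>For empty \<open>X\<close> the difference set does not contain 0, while every
    map satisfies the condition vacuously.\<close>
  case True
  then have "{L :: 'a \<Rightarrow>\<^sub>L (real ^ 'n). almost_bilipschitz_on \<gamma> X (blinfun_apply L)} = UNIV"
    by (auto simp: almost_bilipschitz_on_def intro!: exI[of _ 1] exI[of _ "1 / 2"])
  then show ?thesis by (simp add: prevalent_UNIV)
next
  case False
  let ?Z = "difference_set X" and ?N = "real CARD('n)"
  have zero: "0 \<in> ?Z" using False by (auto simp: difference_set_def)
  obtain s M where s: "s < d" and M: "M \<ge> 1" and hom: "homogeneous_set M s ?Z"
    using assms(2) by (auto simp: assouad_dim_def INF_less_iff)
  have \<alpha>: "\<alpha> \<ge> 0" using assms(4) by (simp split: if_splits)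
  have N: "?N > 0" by simp
  have \<gamma>d: "\<alpha> * ?N + 1 < \<gamma> * (?N - d)" using assms(3,5) by (simp add: pos_divide_less_eq)
  moreover have "0 < \<alpha> * ?N + 1" using \<alpha> N by (simp add: add_nonneg_pos)
  ultimately have "0 < \<gamma> * (?N - d)" by linarith
  then have \<gamma>: "\<gamma> > 0" using assms(3) by (simp add: zero_less_mult_iff)
  have "\<gamma> * (?N - d) \<le> \<gamma> * (?N - s)" using \<gamma> s by simp
  with \<gamma>d have \<gamma>s: "\<alpha> * ?N + 1 < \<gamma> * (?N - s)" by linarith
  \<comment> \<open>Half of the slack in \<open>\<gamma>s\<close>, divided by the dimension. The
    exponent \<open>\<theta>\<close> then equals minus the other half.\<close>
  define \<delta> where "\<delta> = (\<gamma> * (?N - s) - 1 - \<alpha> * ?N) / (2 * ?N)"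
  have \<delta>: "\<delta> > 0" using \<gamma>s N by (simp add: \<delta>_def)
  define \<theta> where "\<theta> = 1 + \<gamma> * s + ?N * (\<alpha> + \<delta> - \<gamma>)"
  have "\<theta> = - (\<gamma> * (?N - s) - 1 - \<alpha> * ?N) / 2"
    using N by (simp add: \<theta>_def \<delta>_def field_simps)
  then have \<theta>: "\<theta> < 0" using \<gamma>s by simp
  obtain m :: nat and \<psi> :: "nat \<Rightarrow> nat \<Rightarrow> 'a \<Rightarrow>\<^sub>L real" where m: "m > 0"
    and \<psi>_bound: "\<And>k x. norm (\<Sum>i<m * 2 ^ k. x i *\<^sub>R \<psi> k i)
      \<le> real (m * 2 ^ k) powr (\<alpha> - 1 / 2) * sqrt (\<Sum>i<m * 2 ^ k. (x i)\<^sup>2)"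
    and \<psi>_low: "\<And>k n z. z \<in> ?Z \<Longrightarrow> 2 ^ k \<le> n \<Longrightarrow> n < 2 ^ Suc k \<Longrightarrow> (1 / 2) ^ n / 4 \<le> norm z \<Longrightarrow>
      norm z < 4 * (1 / 2) ^ n \<Longrightarrow> norm z \<le> 2 * sqrt (\<Sum>i<m * 2 ^ k. (blinfun_apply (\<psi> k i) z)\<^sup>2)"
    by (rule homogeneous_norming_blocks[OF hom M zero assms(4)]) (rule that)
  define D where "D k = m * 2 ^ k" for k :: nat
  have D: "real (D k) > 0" "real (D k) = real m * 2 powr real k" for k
    using m by (auto simp: D_def powr_realpow)
  \<comment> \<open>The power of \<open>D k\<close> cancels the factor of the norming bound together
    with \<open>sqrt (D k)\<close>, the typical length of the coefficient vector. The power of 2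
    leaves geometric decay.\<close>
  define q where "q k = 2 powr (- \<delta> * real k) * real (D k) powr - \<alpha>" for k
  have q: "q k > 0" for k using D(1)[of k] by (simp add: q_def)
  \<comment> \<open>This exceeds the typical length \<open>sqrt (D k)\<close> by a factor that makes
    the tail \<open>D k / (r k)\<^sup>2\<close> geometric, yet consumes only half of the decay in
    \<open>q k\<close>, so that \<open>A k * r k\<close> is still summable.\<close>
  define r where "r k = real (D k) powr (1 / 2) * 2 powr (\<delta> * real k / 2)" for k
  define A where "A k = q k * real (D k) powr (\<alpha> - 1 / 2)" for k
  have Ar: "A k * r k = (2 powr (- \<delta> / 2)) ^ k" for k
  proof -
    have "A k * r k = (2 powr (- \<delta> * real k) * 2 powr (\<delta> * real k / 2)) *
        (real (D k) powr - \<alpha> * real (D k) powr (\<alpha> - 1 / 2) * real (D k) powr (1 / 2))"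
      by (simp add: A_def q_def r_def)
    also have "\<dots> = 2 powr (- \<delta> / 2 * real k)"
      using D(1)[of k] by (simp flip: powr_add)
    finally show ?thesis by (simp add: powr_power mult.commute)
  qed
  interpret random_functional "\<lambda>k i. q k *\<^sub>R \<psi> k i" D A r
  proof
    fix k and x :: "nat \<Rightarrow> real"
    show "r k > 0" "A k \<ge> 0" using D(1)[of k] q[of k] by (auto simp: r_def A_def less_imp_le)
    have "(\<Sum>i<D k. x i *\<^sub>R (q k *\<^sub>R \<psi> k i)) = q k *\<^sub>R (\<Sum>i<D k. x i *\<^sub>R \<psi> k i)"
      by (simp add: scaleR_sum_right mult.commute)
    then have "norm (\<Sum>i<D k. x i *\<^sub>R (q k *\<^sub>R \<psi> k i)) = q k * norm (\<Sum>i<D k. x i *\<^sub>R \<psi> k i)"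
      using q[of k] by simp
    also have "\<dots> \<le> A k * sqrt (\<Sum>i<D k. (x i)\<^sup>2)"
      unfolding A_def mult.assoc
      by (rule mult_left_mono[OF \<psi>_bound[of x k, folded D_def] less_imp_le[OF q]])
    finally show "norm (\<Sum>i<D k. x i *\<^sub>R (q k *\<^sub>R \<psi> k i)) \<le> A k * sqrt (\<Sum>i<D k. (x i)\<^sup>2)" .
    show "summable (\<lambda>k. A k * r k)" unfolding Ar
      using \<delta> by (intro summable_geometric) (simp add: powr_less_one)
  qed
  have Dr: "D k / (r k)\<^sup>2 = (2 powr - \<delta>) ^ k" for k
  proof -
    have "(r k)\<^sup>2 = real (D k) * 2 powr (\<delta> * real k)"
      using D(1)[of k] by (simp add: r_def power_mult_distrib powr_power)
    then have "D k / (r k)\<^sup>2 = 2 powr (- \<delta> * real k)" using D(1)[of k] by (simp add: powr_minus field_simps)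
    then show ?thesis by (simp add: powr_power mult.commute)
  qed
  define t where "t k = 2 powr (- \<gamma> * real k)" for k :: nat
  have t: "0 < t k" "t k \<le> 1" for k using \<gamma> powr_mono[of "- \<gamma> * real k" 0 "2::real"] by (simp_all add: t_def)
  show ?thesis
  proof (rule prevalent_eventually_expanding)
    show "eventually_expanding (dyadic_block ?Z) t
        \<subseteq> {L :: 'a \<Rightarrow>\<^sub>L (real ^ 'n). almost_bilipschitz_on \<gamma> X (blinfun_apply L)}"
      unfolding t_def using eventually_expanding_imp_almost_bilipschitz \<gamma> by blast
  next
    fix v :: "'a \<Rightarrow>\<^sub>L (real ^ 'n)" and R :: nat
    \<comment> \<open>The power of \<open>m\<close> is the part of \<open>1 / q k\<close> that does
      not depend on \<open>k\<close>.\<close>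
    define b where "b = 4 * (1 + real R) * real m powr \<alpha>"
    define c where "c = M * 8 powr s * b ^ CARD('n)"
    have c0: "c \<ge> 0" using M by (simp add: c_def b_def)
    \<comment> \<open>The first term bounds the clipping events. The second is the number of centres
      times the small-ball bound; in \<open>\<theta>\<close> the scales contribute 1, the covers
      \<open>\<gamma> * s\<close>, and the coordinates \<open>\<alpha> + \<delta> - \<gamma>\<close>
      each.\<close>
    define p where "p k = ?N * (2 powr - \<delta>) ^ k + c * (2 powr \<theta>) ^ k" for k
    have "emeasure gauss_vec {\<omega>. norm (Fvec \<omega> + v) \<le> real R \<and>
      (\<exists>z\<in>dyadic_block ?Z k. norm (blinfun_apply (Fvec \<omega> + v) z) < t k * norm z)} \<le> ennreal (p k)" for k
    proof -
      obtain C where C: "finite C" "real (card C) \<le> 2 ^ k * (M * (8 / t k) powr s)"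
        "\<And>c. c \<in> C \<Longrightarrow> \<exists>n. 2 ^ k \<le> n \<and> n < 2 ^ Suc k \<and> (1 / 2) ^ n / 4 \<le> norm c \<and> norm c < 4 * (1 / 2) ^ n"
        "C \<subseteq> ?Z"
        "\<And>z. z \<in> dyadic_block ?Z k \<Longrightarrow> \<exists>c\<in>C. norm (z - c) \<le> t k * norm z \<and> norm z \<le> 2 * norm c"
        using dyadic_block_cover[OF hom zero t(1)[of k] t(2)[of k], of k] by blast
      have "emeasure gauss_vec {\<omega>. norm (Fvec \<omega> + v) \<le> real R \<and>
          (\<exists>z\<in>dyadic_block ?Z k. norm (blinfun_apply (Fvec \<omega> + v) z) < t k * norm z)}
        \<le> ennreal (?N * (D k / (r k)\<^sup>2) + card C * (4 * (1 + real R) * t k / q k) ^ CARD('n))"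
      proof (rule expansion_failure_bound[OF C(1) _ _ C(5) t(1) q])
        fix c assume c: "c \<in> C"
        then obtain n where n: "2 ^ k \<le> n" "n < 2 ^ Suc k" "(1 / 2) ^ n / 4 \<le> norm c" "norm c < 4 * (1 / 2) ^ n"
          using C(3) by blast
        have "(1 / 2 :: real) ^ n / 4 > 0" by simp
        then have "norm c > 0" using n(3) by linarith
        then show "c \<noteq> 0" by simp
        have "norm c \<le> 2 * sqrt (\<Sum>i<D k. (blinfun_apply (\<psi> k i) c)\<^sup>2)"
          unfolding D_def by (rule \<psi>_low[OF _ n]) (use c C(4) in blast)
        then have "q k * norm c \<le> q k * (2 * sqrt (\<Sum>i<D k. (blinfun_apply (\<psi> k i) c)\<^sup>2))"
          using q[of k] by (intro mult_left_mono) auto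
        also have "\<dots> = 2 * sqrt (\<Sum>i<D k. (blinfun_apply (q k *\<^sub>R \<psi> k i) c)\<^sup>2)"
          using q[of k] by (simp add: blinfun.scaleR_left power_mult_distrib real_sqrt_mult flip: sum_distrib_left)
        finally show "q k * norm c \<le> 2 * sqrt (\<Sum>i<D k. (blinfun_apply (q k *\<^sub>R \<psi> k i) c)\<^sup>2)" .
      qed simp_all
      also have "\<dots> \<le> ennreal (p k)"
      proof (rule ennreal_leI)
        have tq: "t k / q k = 2 powr ((\<alpha> + \<delta> - \<gamma>) * real k) * real m powr \<alpha>"
        proof -
          have "t k / q k = 2 powr (- \<gamma> * real k) * 2 powr (\<delta> * real k) * real (D k) powr \<alpha>"
            by (simp add: t_def q_def powr_minus field_simps)
          also have "real (D k) powr \<alpha> = real m powr \<alpha> * 2 powr (\<alpha> * real k)"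
            unfolding D(2) by (simp add: powr_mult powr_powr mult.commute)
          finally have "t k / q k = 2 powr (- \<gamma> * real k) * 2 powr (\<delta> * real k) * 2 powr (\<alpha> * real k) * real m powr \<alpha>"
            by (simp add: mult_ac)
          also have "2 powr (- \<gamma> * real k) * 2 powr (\<delta> * real k) * 2 powr (\<alpha> * real k)
              = 2 powr ((\<alpha> + \<delta> - \<gamma>) * real k)"
            unfolding powr_add[symmetric] by (simp add: algebra_simps)
          finally show ?thesis .
        qed
        have "4 * (1 + real R) * t k / q k = 4 * (1 + real R) * (t k / q k)" by simp
        also have "\<dots> = b * 2 powr ((\<alpha> + \<delta> - \<gamma>) * real k)"
          unfolding tq b_def by (simp only: mult_ac)
        finally have "(4 * (1 + real R) * t k / q k) ^ CARD('n)
            = b ^ CARD('n) * (2 powr ((\<alpha> + \<delta> - \<gamma>) * real k)) ^ CARD('n)"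
          by (simp only: power_mult_distrib)
        also have "(2 powr ((\<alpha> + \<delta> - \<gamma>) * real k)) ^ CARD('n) = 2 powr (?N * (\<alpha> + \<delta> - \<gamma>) * real k)"
          by (simp add: powr_power mult_ac)
        finally have 1: "(4 * (1 + real R) * t k / q k) ^ CARD('n)
            = b ^ CARD('n) * 2 powr (?N * (\<alpha> + \<delta> - \<gamma>) * real k)" .
        have "8 / t k = 8 * 2 powr (\<gamma> * real k)" by (simp add: t_def powr_minus_divide)
        then have "(8 / t k) powr s = 8 powr s * 2 powr (\<gamma> * s * real k)"
          by (simp add: powr_mult powr_powr mult_ac)
        then have 2: "2 ^ k * (M * (8 / t k) powr s) = M * 8 powr s * (2 powr real k * 2 powr (\<gamma> * s * real k))"
          by (simp add: powr_realpow mult_ac)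
        have "real (card C) * (4 * (1 + real R) * t k / q k) ^ CARD('n)
            \<le> 2 ^ k * (M * (8 / t k) powr s) * (4 * (1 + real R) * t k / q k) ^ CARD('n)"
          using C(2) t(1)[of k] q[of k] by (intro mult_right_mono) auto
        also have "\<dots> = c * (2 powr real k * 2 powr (\<gamma> * s * real k) * 2 powr (?N * (\<alpha> + \<delta> - \<gamma>) * real k))"
          unfolding 1 2 c_def by (simp add: mult_ac)
        also have "2 powr real k * 2 powr (\<gamma> * s * real k) * 2 powr (?N * (\<alpha> + \<delta> - \<gamma>) * real k)
            = 2 powr (\<theta> * real k)"
          unfolding powr_add[symmetric] by (simp add: \<theta>_def algebra_simps)
        also have "2 powr (\<theta> * real k) = (2 powr \<theta>) ^ k" by (simp add: powr_power mult.commute)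
        finally show "?N * (D k / (r k)\<^sup>2) + card C * (4 * (1 + real R) * t k / q k) ^ CARD('n) \<le> p k"
          by (simp add: p_def Dr)
      qed
      finally show ?thesis .
    qed
    moreover have "summable p"
      unfolding p_def using \<delta> \<theta>
      by (intro summable_add summable_mult summable_geometric) (auto simp: powr_less_one)
    moreover have "p k \<ge> 0" for k using c0 by (simp add: p_def)
    ultimately show "\<exists>p. summable p \<and> (\<forall>k. 0 \<le> p k \<and> emeasure gauss_vec {\<omega>. norm (Fvec \<omega> + v) \<le> real R \<and>
      (\<exists>z\<in>dyadic_block ?Z k. norm (blinfun_apply (Fvec \<omega> + v) z) < t k * norm z)} \<le> ennreal (p k))"
      by (intro exI[of _ p]) blast
  qed
qed

end
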